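(* Let $p>1$ and let $\varphi_0(x)=2^{1/(p-1)}e^{-|x|}$ for $x\in\mathbb{R}$. For any $\psi\in H^1(\mathbb{R})$ (complex-valued), $$|\psi(0)|^2\le \|\psi\|_{L^2(\mathbb{R})}\,\|\psi'\|_{L^2(\mathbb{R})}.$$ Equality is achieved if and only if there exist $\theta\in\mathbb{R}$, $\alpha>0$ and $\beta>0$ such that $\psi(x)=e^{i\theta}\alpha\,\varphi_0(\beta x)$.
   Context: $H^1(\mathbb{R})$ is the usual Sobolev space of complex-valued functions; $\psi(0)$ denotes the value at $0$ of the continuous representative of $\psi$. The function $\varphi_0$ is the ground state, i.e. the solution of $0=\varphi_0-\partial_x^2\varphi_0-\delta|\varphi_0|^{p-1}\varphi_0$, where $\delta=\delta(x)$ is the delta function at the origin.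
   Formalization: The equality characterization is stated only for ψ not almost everywhere zero, because for ψ = 0 equality holds trivially although ψ is not of the form e^{iθ}αφ₀(βx) with α > 0. *)

theory Defs
  imports "HOL-Analysis.Analysis"
begin

text \<open>
  Elements of $L^2$ and $H^1$ are represented by functions, to be thought of up to equality
  almost everywhere with respect to Lebesgue measure.
\<close>

definition L2 :: "(real \<Rightarrow> complex) set" where
  "L2 = {f. f \<in> borel_measurable lebesgue \<and> integrable lebesgue (\<lambda>x. (cmod (f x))\<^sup>2)}"

definition L2_norm :: "(real \<Rightarrow> complex) \<Rightarrow> real" where
  "L2_norm f = sqrt (LINT x|lebesgue. (cmod (f x))\<^sup>2)"

definition test_fun :: "(real \<Rightarrow> real) set" where
  "test_fun = {\<phi>. (\<forall>n x. (deriv ^^ n) \<phi> field_differentiable (at x)) \<and>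
                   compact (closure {x. \<phi> x \<noteq> 0})}"

definition locally_integrable :: "(real \<Rightarrow> complex) \<Rightarrow> bool" where
  "locally_integrable f \<longleftrightarrow> (\<forall>a b. set_integrable lebesgue {a..b} f)"

text \<open>
  Real-valued test functions suffice: the identity for complex-valued ones follows by linearity.
\<close>

definition has_weak_derivative :: "(real \<Rightarrow> complex) \<Rightarrow> (real \<Rightarrow> complex) \<Rightarrow> bool" where
  "has_weak_derivative f g \<longleftrightarrow>
     locally_integrable f \<and> locally_integrable g \<and>
     (\<forall>\<phi>\<in>test_fun. (LINT x|lebesgue. f x * of_real (deriv \<phi> x)) =
                   - (LINT x|lebesgue. g x * of_real (\<phi> x)))"

text \<open>
  The weak derivative is unique only almost everywhere, so an arbitrary one is chosen.
\<close>

definition weak_deriv :: "(real \<Rightarrow> complex) \<Rightarrow> (real \<Rightarrow> complex)" where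
  "weak_deriv f = (SOME g. has_weak_derivative f g)"

definition H1 :: "(real \<Rightarrow> complex) set" where
  "H1 = {f. f \<in> L2 \<and> (\<exists>g\<in>L2. has_weak_derivative f g)}"

definition cont_rep :: "(real \<Rightarrow> complex) \<Rightarrow> (real \<Rightarrow> complex)" where
  "cont_rep f = (THE u. continuous_on UNIV u \<and> (AE x in lebesgue. f x = u x))"

definition ground_state :: "real \<Rightarrow> real \<Rightarrow> real" where
  "ground_state p x = 2 powr (1 / (p - 1)) * exp (- \<bar>x\<bar>)"

end

theory Submission
  imports Defs
begin

text \<open>
  Let $u$ be the continuous representative of $\psi$ and $g$ its weak derivative, so that $u$ is
  an indefinite integral of $g$ and vanishes at infinity. Since $2\,\mathrm{Re}(\bar u g)$ is the
  density of $|u|^2$, for every real $l$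
  $$\|g + l\,\mathrm{sgn}(x)\,u\|^2 = \|g\|^2 - 2 l\,|u(0)|^2 + l^2\,\|u\|^2.$$
  The inequality is the nonnegativity of the left side at the minimising $l$. Equality forces
  $g = - l\,\mathrm{sgn}(x)\,u$, that is, $u(x) = u(0) e^{-l|x|}$.
\<close>

section \<open>Smooth bump functions\<close>

text \<open>The hypothesis gives much less than an indefinite integral: only an identity tested
  against smooth compactly supported functions. Most of the development bridges this gap. A supply
  of test functions is built from exp(-1/x), and the du Bois-Reymond lemma turns a vanishing weak
  derivative into constancy. Pointwise derivatives of a general u are never taken: the density of
  |u|^2 comes from a product rule for indefinite integrals, which is Fubini's theorem on a square.
  The factor sgn is there because the density of |u|^2 integrates to 0 over the whole line; only
  with opposite signs on the two half lines do the contributions of u(0) add up instead of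
  cancelling.\<close>

definition smooth :: "(real \<Rightarrow> real) \<Rightarrow> bool" where
  "smooth f \<longleftrightarrow> (\<forall>n x. (deriv ^^ n) f field_differentiable (at x))"

text \<open>Smooth functions form the largest class of differentiable functions closed under
  \<open>deriv\<close>. Smoothness thus follows from any class that contains f and has this closure
  property, and no formula for the n-th derivative is ever needed.\<close>

lemma smooth_coinduct:
  assumes "f \<in> S"
    and "\<And>h. h \<in> S \<Longrightarrow> (\<forall>x. h field_differentiable (at x)) \<and> deriv h \<in> S"
  shows "smooth f"
proof -
  have "(deriv ^^ n) f \<in> S" for n
    by (induction n) (use assms in auto)
  then show ?thesis
    using assms(2) by (auto simp: smooth_def)
qed

lemma smooth_imp_differentiable: "smooth f \<Longrightarrow> f field_differentiable (at x)"
  unfolding smooth_def by (metis funpow_0)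

lemma smooth_DERIV: "smooth f \<Longrightarrow> (f has_field_derivative deriv f x) (at x)"
  by (simp add: DERIV_deriv_iff_field_differentiable smooth_imp_differentiable)

lemma smooth_deriv: "smooth f \<Longrightarrow> smooth (deriv f)"
  unfolding smooth_def by (metis comp_apply funpow_Suc_right)

lemma smooth_antideriv:
  assumes "\<And>x. (F has_field_derivative f x) (at x)" and "smooth f"
  shows "smooth F"
proof (rule smooth_coinduct[where S = "insert F {h. smooth h}"])
  have "deriv F = f"
    using assms(1) DERIV_imp_deriv by blast
  then show "(\<forall>x. h field_differentiable (at x)) \<and> deriv h \<in> insert F {h. smooth h}"
    if "h \<in> insert F {h. smooth h}" for h
    using that assms smooth_imp_differentiable smooth_deriv
    by (auto simp: field_differentiable_def)
qed auto

lemma smooth_const: "smooth (\<lambda>_. c)"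
proof (rule smooth_coinduct[where S = "range (\<lambda>c _. c)"])
  fix h :: "real \<Rightarrow> real" assume "h \<in> range (\<lambda>c _. c)"
  then show "(\<forall>x. h field_differentiable (at x)) \<and> deriv h \<in> range (\<lambda>c _. c)"
    by auto
qed auto

lemma smooth_add:
  assumes "smooth f" "smooth g"
  shows "smooth (\<lambda>x. f x + g x)"
proof (rule smooth_coinduct[where S = "{\<lambda>x. f x + g x |f g. smooth f \<and> smooth g}"])
  fix h assume "h \<in> {\<lambda>x. f x + g x |f g. smooth f \<and> smooth g}"
  then obtain f g where h: "h = (\<lambda>x. f x + g x)" and fg: "smooth f" "smooth g"
    by blast
  have D: "(h has_field_derivative (deriv f x + deriv g x)) (at x)" for x
    unfolding h by (intro derivative_intros smooth_DERIV fg)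
  then have "deriv h = (\<lambda>x. deriv f x + deriv g x)"
    using DERIV_imp_deriv by blast
  moreover have "smooth (deriv f)" "smooth (deriv g)"
    using fg by (simp_all add: smooth_deriv)
  moreover have "\<forall>x. h field_differentiable (at x)"
    using D by (meson field_differentiable_def)
  ultimately show "(\<forall>x. h field_differentiable (at x)) \<and> deriv h \<in> {\<lambda>x. f x + g x |f g. smooth f \<and> smooth g}"
    by blast
qed (use assms in blast)

text \<open>Differentiation maps products of smooth functions only to sums of such products, so the
  coinduction for products runs over all finite sums.\<close>

inductive_set product_sums :: "(real \<Rightarrow> real) set" where
  mult: "smooth f \<Longrightarrow> smooth g \<Longrightarrow> (\<lambda>x. f x * g x) \<in> product_sums"
| add: "u \<in> product_sums \<Longrightarrow> v \<in> product_sums \<Longrightarrow> (\<lambda>x. u x + v x) \<in> product_sums"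

lemma smooth_mult:
  assumes "smooth f" "smooth g"
  shows "smooth (\<lambda>x. f x * g x)"
proof (rule smooth_coinduct[where S = product_sums])
  show "(\<forall>x. h field_differentiable (at x)) \<and> deriv h \<in> product_sums" if "h \<in> product_sums" for h
    using that
  proof (induction h rule: product_sums.induct)
    case (mult f g)
    have D: "((\<lambda>x. f x * g x) has_field_derivative (deriv f x * g x + f x * deriv g x)) (at x)" for x
      using DERIV_mult[OF smooth_DERIV[OF mult(1)] smooth_DERIV[OF mult(2)], of x]
      by (simp add: mult.commute add.commute)
    then have "deriv (\<lambda>x. f x * g x) = (\<lambda>x. deriv f x * g x + f x * deriv g x)"
      using DERIV_imp_deriv by blast
    moreover have "(\<lambda>x. deriv f x * g x + f x * deriv g x) \<in> product_sums"
      by (intro product_sums.intros mult smooth_deriv)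
    ultimately show ?case
      using D by (auto simp: field_differentiable_def)
  next
    case (add u v)
    have D: "((\<lambda>x. u x + v x) has_field_derivative (deriv u x + deriv v x)) (at x)" for x
      using add.IH by (intro derivative_intros) (auto simp: DERIV_deriv_iff_field_differentiable)
    then have "deriv (\<lambda>x. u x + v x) = (\<lambda>x. deriv u x + deriv v x)"
      using DERIV_imp_deriv by blast
    with D add.IH show ?case
      by (auto simp: field_differentiable_def intro: product_sums.add)
  qed
qed (use assms product_sums.mult in blast)

lemma smooth_compose_affine:
  assumes "smooth f"
  shows "smooth (\<lambda>x. f (m * x + c))"
\<comment> \<open>The scalar \<open>k\<close> absorbs the factor \<open>m\<close> that the chain
  rule produces at each differentiation.\<close>
proof (rule smooth_coinduct[where S = "{\<lambda>x. k * f (m * x + c) |k f. smooth f}"])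
  show "(\<lambda>x. f (m * x + c)) \<in> {\<lambda>x. k * f (m * x + c) |k f. smooth f}"
    using assms by (intro CollectI exI[of _ 1] exI[of _ f]) simp
  fix h assume "h \<in> {\<lambda>x. k * f (m * x + c) |k f. smooth f}"
  then obtain k f where h: "h = (\<lambda>x. k * f (m * x + c))" and f: "smooth f"
    by blast
  have D: "(h has_field_derivative (k * m * deriv f (m * x + c))) (at x)" for x
    unfolding h
    by (rule DERIV_cong[OF DERIV_cmult[OF DERIV_chain2[OF smooth_DERIV[OF f]]]]) (auto intro!: derivative_eq_intros)
  then have "deriv h = (\<lambda>x. k * m * deriv f (m * x + c))"
    using DERIV_imp_deriv by blast
  moreover have "\<forall>x. h field_differentiable (at x)"
    using D by (meson field_differentiable_def)
  ultimately show "(\<forall>x. h field_differentiable (at x)) \<and> deriv h \<in> {\<lambda>x. k * f (m * x + c) |k f. smooth f}"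
    using smooth_deriv[OF f] by blast
qed

text \<open>The classical function exp(-1/x), extended by 0 to the left. The polynomial in 1/x is
  carried along because every derivative has this shape, so that the family is closed under
  differentiation.\<close>

definition flat :: "real poly \<Rightarrow> real \<Rightarrow> real" where
  "flat P x = (if x > 0 then poly P (1 / x) * exp (- (1 / x)) else 0)"

lemma poly_exp_minus_tendsto_0: "((\<lambda>y. poly P y * exp (- y)) \<longlongrightarrow> (0::real)) at_top"
proof -
  have "((\<lambda>y. \<Sum>i\<le>degree P. coeff P i * (y ^ i / exp y)) \<longlongrightarrow> (\<Sum>i\<le>degree P. coeff P i * 0)) at_top"
    by (intro tendsto_intros tendsto_power_div_exp_0)
  moreover have "(\<lambda>y. \<Sum>i\<le>degree P. coeff P i * (y ^ i / exp y)) = (\<lambda>y. poly P y * exp (- y))"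
    by (simp add: poly_altdef sum_distrib_right exp_minus divide_inverse mult.assoc)
  ultimately show ?thesis
    by simp
qed

text \<open>In the variable $y = 1/x$, differentiation acts on the polynomial factor as
  $P \mapsto y^2 (P - P')$.\<close>

lemma flat_DERIV:
  "(flat P has_field_derivative flat (monom 1 2 * (P - pderiv P)) x) (at x)"
proof -
  consider "x > 0" | "x < 0" | "x = 0" by linarith
  then show ?thesis
  proof cases
    case 1
    have inv: "((\<lambda>x. 1 / x) has_field_derivative - (1 / x ^ 2)) (at x)"
      using 1 by (auto intro!: derivative_eq_intros simp: power2_eq_square)
    have "((\<lambda>x. poly P (1 / x)) has_field_derivative poly (pderiv P) (1 / x) * - (1 / x ^ 2)) (at x)"
      by (rule DERIV_chain2[OF poly_DERIV inv])
    moreover have "((\<lambda>x. exp (- (1 / x))) has_field_derivative exp (- (1 / x)) * - (- (1 / x ^ 2))) (at x)"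
      by (rule DERIV_chain2[OF DERIV_exp DERIV_minus[OF inv]])
    ultimately have "((\<lambda>x. poly P (1 / x) * exp (- (1 / x))) has_field_derivative
        poly (pderiv P) (1 / x) * - (1 / x ^ 2) * exp (- (1 / x))
        + exp (- (1 / x)) * - (- (1 / x ^ 2)) * poly P (1 / x)) (at x)"
      by (rule DERIV_mult)
    moreover have "poly (pderiv P) (1 / x) * - (1 / x ^ 2) * exp (- (1 / x))
        + exp (- (1 / x)) * - (- (1 / x ^ 2)) * poly P (1 / x) = flat (monom 1 2 * (P - pderiv P)) x"
      using 1 by (simp add: flat_def poly_monom power_one_over) (simp add: algebra_simps diff_divide_distrib)
    ultimately have "((\<lambda>x. poly P (1 / x) * exp (- (1 / x))) has_field_derivative flat (monom 1 2 * (P - pderiv P)) x) (at x)"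
      by simp
    moreover have "\<forall>\<^sub>F y in nhds x. flat P y = poly P (1 / y) * exp (- (1 / y))"
      using eventually_nhds_in_open[of "{0<..}" x] 1
      by (auto elim!: eventually_mono simp: flat_def)
    ultimately show ?thesis
      by (rule iffD2[OF DERIV_cong_ev[OF refl _ refl], rotated])
  next
    case 2
    have "((\<lambda>_. 0) has_field_derivative flat (monom 1 2 * (P - pderiv P)) x) (at x)"
      using 2 unfolding flat_def by auto
    moreover have "\<forall>\<^sub>F y in nhds x. flat P y = 0"
      using eventually_nhds_in_open[of "{..<0}" x] 2
      by (auto elim!: eventually_mono simp: flat_def)
    ultimately show ?thesis
      by (rule iffD2[OF DERIV_cong_ev[OF refl _ refl], rotated])
  next
    case 3
    \<comment> \<open>\<open>pCons 0 P\<close> is the polynomial y P(y): the difference quotient at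
      0 brings one more factor 1/y, which the exponential still beats.\<close>
    have "((\<lambda>y. poly (pCons 0 P) (inverse y) * exp (- inverse y)) \<longlongrightarrow> 0) (at_right (0::real))"
      by (rule filterlim_compose[OF poly_exp_minus_tendsto_0 filterlim_inverse_at_top_right])
    then have "((\<lambda>y. flat P y / y) \<longlongrightarrow> 0) (at_right 0)"
      by (rule Lim_transform_eventually)
         (simp add: eventually_at_right_field flat_def inverse_eq_divide exI[of _ 1])
    moreover have "((\<lambda>y. flat P y / y) \<longlongrightarrow> 0) (at_left 0)"
      by (rule Lim_transform_eventually[OF tendsto_const])
         (simp add: eventually_at_left_field flat_def exI[of _ "-1"])
    ultimately have "((\<lambda>y. flat P y / y) \<longlongrightarrow> 0) (at 0)"
      by (simp add: filterlim_split_at)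
    then show ?thesis
      using 3 by (simp add: has_field_derivative_iff flat_def)
  qed
qed

lemma smooth_flat: "smooth (flat P)"
proof (rule smooth_coinduct[where S = "range flat"])
  fix h assume "h \<in> range flat"
  then obtain P where h: "h = flat P" by blast
  have "deriv h = flat (monom 1 2 * (P - pderiv P))"
    unfolding h by (rule ext, rule DERIV_imp_deriv, rule flat_DERIV)
  then have "deriv h \<in> range flat"
    by simp
  moreover have "\<forall>x. h field_differentiable (at x)"
    unfolding h field_differentiable_def by (intro allI exI, rule flat_DERIV)
  ultimately show "(\<forall>x. h field_differentiable (at x)) \<and> deriv h \<in> range flat"
    by blast
qed auto

section \<open>Test functions, bumps and their antiderivatives\<close>

lemma test_funI:
  assumes "smooth \<phi>" and "\<And>x. x \<notin> {a..b} \<Longrightarrow> \<phi> x = 0"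
  shows "\<phi> \<in> test_fun"
proof -
  have "{x. \<phi> x \<noteq> 0} \<subseteq> {a..b}"
    using assms(2) by blast
  then have "bounded {x. \<phi> x \<noteq> 0}"
    using bounded_subset bounded_closed_interval by blast
  then show ?thesis
    using assms(1) by (simp add: test_fun_def smooth_def)
qed

lemma test_funE:
  assumes "\<phi> \<in> test_fun"
  obtains M where "smooth \<phi>" "M > 0" "\<And>x. \<bar>x\<bar> \<ge> M \<Longrightarrow> \<phi> x = 0"
proof -
  have "bounded {x. \<phi> x \<noteq> 0}"
    using assms by (simp add: test_fun_def)
  then obtain B where "B > 0" and B: "\<forall>x\<in>{x. \<phi> x \<noteq> 0}. norm x \<le> B"
    unfolding bounded_pos by (elim exE conjE)
  show thesis
  \<comment> \<open>The bound \<open>B\<close> only yields zeros for |x| > B. Enlarging it makes the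
    function vanish at the endpoints themselves, as the boundary terms of an integration by parts
    require.\<close>
  proof (rule that[of "B + 1"])
    show "smooth \<phi>"
      using assms by (simp add: test_fun_def smooth_def)
    show "B + 1 > 0"
      using \<open>B > 0\<close> by simp
    show "\<phi> x = 0" if "\<bar>x\<bar> \<ge> B + 1" for x
    proof (rule ccontr)
      assume "\<phi> x \<noteq> 0"
      with B have "norm x \<le> B" by simp
      with that show False by simp
    qed
  qed
qed

text \<open>On (a, b) this is exp(-1/(n(x - a)) - 1/(n(b - x))). As n grows it tends pointwise to
  the indicator of (a, b) while staying below 1, which gives access to intervals by dominated
  convergence, without convolutions.\<close>

definition bump :: "real \<Rightarrow> real \<Rightarrow> nat \<Rightarrow> real \<Rightarrow> real" where
  "bump a b n x = flat 1 (real n * (x - a)) * flat 1 (real n * (b - x))"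

lemma smooth_bump: "smooth (bump a b n)"
proof -
  have "bump a b n = (\<lambda>x. flat 1 (real n * x + - (real n * a)) * flat 1 (- real n * x + real n * b))"
    by (simp add: bump_def fun_eq_iff algebra_simps)
  then show ?thesis
    by (simp only: smooth_mult smooth_compose_affine smooth_flat)
qed

lemma bump_eq_0: "x \<notin> {a<..<b} \<Longrightarrow> bump a b n x = 0"
  by (auto simp: bump_def flat_def zero_less_mult_iff)

lemma bump_test_fun: "bump a b n \<in> test_fun"
  by (rule test_funI[OF smooth_bump, of a b]) (auto simp: bump_eq_0)

lemma bump_nonneg: "bump a b n x \<ge> 0"
  by (simp add: bump_def flat_def)

lemma bump_le_1: "bump a b n x \<le> 1"
  by (auto simp: bump_def flat_def intro!: mult_le_one)

lemma bump_pos: "x \<in> {a<..<b} \<Longrightarrow> n > 0 \<Longrightarrow> bump a b n x > 0"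
  by (auto simp: bump_def flat_def)

lemma bump_tendsto: "(\<lambda>n. bump a b n x) \<longlonglongrightarrow> indicator {a<..<b} x"
proof (cases "x \<in> {a<..<b}")
  case True
  have *: "(\<lambda>n. exp (- (1 / (real n * c)))) \<longlonglongrightarrow> 1" if "c > 0" for c :: real
  proof -
    have "(\<lambda>n. - (1 / c) * inverse (real n)) \<longlonglongrightarrow> - (1 / c) * 0"
      by (intro tendsto_intros lim_inverse_n)
    then have "(\<lambda>n. exp (- (1 / c) * inverse (real n))) \<longlonglongrightarrow> exp 0"
      by (intro tendsto_exp) simp
    moreover have "- (1 / c) * inverse (real n) = - (1 / (real n * c))" for n
      by (simp add: inverse_eq_divide)
    ultimately show ?thesis
      by simp
  qed
  have "(\<lambda>n. exp (- (1 / (real n * (x - a)))) * exp (- (1 / (real n * (b - x))))) \<longlonglongrightarrow> 1 * 1"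
    using True by (intro tendsto_mult *) auto
  then have "(\<lambda>n. exp (- (1 / (real n * (x - a)))) * exp (- (1 / (real n * (b - x))))) \<longlonglongrightarrow> 1"
    by simp
  then have "(\<lambda>n. bump a b n x) \<longlonglongrightarrow> 1"
    by (rule Lim_transform_eventually)
       (use True in \<open>auto intro!: eventually_mono[OF eventually_gt_at_top[of 0]] simp: bump_def flat_def\<close>)
  then show ?thesis
    using True by simp
qed (simp add: bump_eq_0)

text \<open>The antiderivative normalised to vanish at the left end of the support equals, beyond
  the right end, the total integral of the function. Mean zero is therefore exactly what keeps its
  support compact.\<close>

lemma test_fun_antideriv:
  assumes "\<phi> \<in> test_fun" and int0: "(LINT x|lebesgue. \<phi> x) = 0"
  obtains \<Phi> where "\<Phi> \<in> test_fun" "deriv \<Phi> = \<phi>"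
proof -
  obtain M where sm: "smooth \<phi>" and M: "M > 0" "\<And>x. \<bar>x\<bar> \<ge> M \<Longrightarrow> \<phi> x = 0"
    using assms(1) by (elim test_funE) blast
  have cont: "isCont \<phi> x" for x
    using smooth_DERIV[OF sm] DERIV_isCont by blast
  then have "\<exists>F. \<forall>x. -\<infinity> < ereal x \<longrightarrow> ereal x < \<infinity> \<longrightarrow> (F has_vector_derivative \<phi> x) (at x)"
    by (intro einterval_antiderivative) auto
  then obtain F where F: "\<And>x. (F has_field_derivative \<phi> x) (at x)"
    by (auto simp: has_real_derivative_iff_has_vector_derivative)
  have Fv: "(F has_vector_derivative \<phi> x) (at x within S)" for x S
    using has_field_derivative_at_within[OF F]
    by (simp only: has_real_derivative_iff_has_vector_derivative)
  define \<Phi> where "\<Phi> x = F x - F (-M)" for x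
  have D: "(\<Phi> has_field_derivative \<phi> x) (at x)" for x
    unfolding \<Phi>_def by (auto intro!: derivative_eq_intros F)
  have const: "F x = F y" if "\<And>z. z \<in> {x..y} \<Longrightarrow> \<phi> z = 0" "x \<le> y" for x y
  proof -
    have "(\<phi> has_integral (F y - F x)) {x..y}"
      using that(2) Fv by (rule fundamental_theorem_of_calculus)
    moreover have "(\<phi> has_integral 0) {x..y}"
      using that by (intro has_integral_is_0) auto
    ultimately have "F y - F x = 0"
      by (rule has_integral_unique)
    then show ?thesis
      by simp
  qed
  have "set_integrable lebesgue {-M..M} \<phi>"
    by (intro absolutely_integrable_continuous_real continuous_at_imp_continuous_on ballI cont)
  moreover have "indicator {-M..M} x *\<^sub>R \<phi> x = \<phi> x" for x
    using M(2)[of x] by (cases "\<bar>x\<bar> \<ge> M") (auto simp: indicator_def)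
  then have "(LINT x:{-M..M}|lebesgue. \<phi> x) = (LINT x|lebesgue. \<phi> x)"
    by (simp only: set_lebesgue_integral_def)
  ultimately have "integral {-M..M} \<phi> = 0"
    using set_lebesgue_integral_eq_integral(2)[of "{-M..M}" \<phi>] int0 by simp
  moreover have "(\<phi> has_integral (F M - F (-M))) {-M..M}"
    using M Fv by (intro fundamental_theorem_of_calculus) auto
  ultimately have FM: "F M = F (-M)"
    by (simp add: has_integral_iff)
  have "\<Phi> \<in> test_fun"
  proof (rule test_funI)
    show "smooth \<Phi>"
      using D sm by (rule smooth_antideriv)
    show "\<Phi> x = 0" if "x \<notin> {-M..M}" for x
    proof (cases "x < -M")
      case True
      then show ?thesis
        using const[of x "-M"] M by (auto simp: \<Phi>_def)
    next
      case False
      then show ?thesis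
        using const[of M x] that M FM by (auto simp: \<Phi>_def)
    qed
  qed
  moreover have "deriv \<Phi> = \<phi>"
    by (rule ext, rule DERIV_imp_deriv, rule D)
  ultimately show thesis
    using that by blast
qed

section \<open>Integration by parts for indefinite Lebesgue integrals\<close>

text \<open>Fubini's theorem is applied on the product of two copies of \<open>lborel\<close>, so
  Lebesgue measurable integrands are exchanged for Borel ones that agree almost everywhere. The
  exchange is made for real and imaginary parts separately.\<close>

lemma lebesgue_integrable_borel_version:
  fixes f :: "real \<Rightarrow> complex"
  assumes "integrable lebesgue f"
  obtains f' where "integrable lborel f'" "AE x in lborel. f x = f' x"
proof -
  have "(\<lambda>x. Re (f x)) \<in> borel_measurable lebesgue" "(\<lambda>x. Im (f x)) \<in> borel_measurable lebesgue"
    using assms by auto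
  from this[THEN completion_ex_borel_measurable_real]
  obtain r s where [measurable]: "r \<in> borel_measurable lborel" "s \<in> borel_measurable lborel"
    and rs: "AE x in lborel. Re (f x) = r x" "AE x in lborel. Im (f x) = s x"
    by blast
  define f' where "f' x = Complex (r x) (s x)" for x
  have [measurable]: "f' \<in> borel_measurable lborel"
    by (subst borel_measurable_complex_iff) (simp add: f'_def)
  have ae: "AE x in lborel. f x = f' x"
    using rs by eventually_elim (simp add: f'_def complex_eq_iff)
  have "integrable lebesgue f'"
    by (rule integrable_cong_AE_imp[OF assms])
       (use ae in \<open>auto intro: AE_completion measurable_completion\<close>)
  then have "integrable lborel f'"
    by (simp add: integrable_completion)
  with ae show thesis
    using that by blast
qed

text \<open>The function f(s) g(t) is integrable on the plane. The two summands are its integrals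
  over {s <= t} and over the complement {t < s}, iterated in opposite orders: s is integrated out
  first in one, t in the other.\<close>

lemma lborel_integral_triangles:
  fixes f g :: "real \<Rightarrow> complex"
  assumes f: "integrable lborel f" and g: "integrable lborel g"
  shows "integrable lborel (\<lambda>t. (LINT s:{..t}|lborel. f s) * g t)" (is ?i1)
    and "integrable lborel (\<lambda>s. f s * (LINT t:{..<s}|lborel. g t))" (is ?i2)
    and "(LINT t|lborel. (LINT s:{..t}|lborel. f s) * g t)
         + (LINT s|lborel. f s * (LINT t:{..<s}|lborel. g t))
         = (LINT s|lborel. f s) * (LINT t|lborel. g t)" (is ?eq)
proof -
  note [measurable] = borel_measurable_integrable[OF f] borel_measurable_integrable[OF g]
  define h where "h p = f (fst p) * g (snd p)" for p
  have [measurable]: "h \<in> borel_measurable (lborel \<Otimes>\<^sub>M lborel)"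
    unfolding h_def by measurable
  have h: "integrable (lborel \<Otimes>\<^sub>M lborel) h"
  proof (rule lborel_pair.Fubini_integrable)
    show "integrable lborel (\<lambda>x. LINT y|lborel. norm (h (x, y)))"
      using f by (simp add: h_def norm_mult)
    show "AE x in lborel. integrable lborel (\<lambda>y. h (x, y))"
      using g by (simp add: h_def)
  qed simp
  define A where "A = {p :: real \<times> real. fst p \<le> snd p}"
  have [measurable]: "A \<in> sets (lborel \<Otimes>\<^sub>M lborel)"
  proof -
    have "A = {p \<in> space (lborel \<Otimes>\<^sub>M lborel). fst p \<le> snd p}"
      by (auto simp: A_def space_pair_measure)
    also have "\<dots> \<in> sets (lborel \<Otimes>\<^sub>M lborel)"
      by measurable
    finally show ?thesis .
  qed
  define h1 where "h1 p = indicat_real A p *\<^sub>R h p" for p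
  define h2 where "h2 p = indicat_real (space (lborel \<Otimes>\<^sub>M lborel) - A) p *\<^sub>R h p" for p
  have h1: "integrable (lborel \<Otimes>\<^sub>M lborel) h1" and h2: "integrable (lborel \<Otimes>\<^sub>M lborel) h2"
    unfolding h1_def h2_def by (intro integrable_mult_indicator h; measurable)+
  have "h = (\<lambda>p. h1 p + h2 p)"
    by (auto simp: fun_eq_iff h1_def h2_def indicator_def space_pair_measure)
  then have hsum: "integral\<^sup>L (lborel \<Otimes>\<^sub>M lborel) h
      = integral\<^sup>L (lborel \<Otimes>\<^sub>M lborel) h1 + integral\<^sup>L (lborel \<Otimes>\<^sub>M lborel) h2"
    using Bochner_Integration.integral_add[OF h1 h2] by simp
  have e1: "(LINT s|lborel. h1 (s, t)) = (LINT s:{..t}|lborel. f s) * g t" for t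
  proof -
    have "(\<lambda>s. h1 (s, t)) = (\<lambda>s. indicator {..t} s *\<^sub>R f s * g t)"
      by (auto simp: h1_def h_def A_def indicator_def fun_eq_iff)
    then show ?thesis
      by (simp only: set_lebesgue_integral_def integral_mult_left_zero integral_mult_right_zero)
  qed
  have e2: "(LINT t|lborel. h2 (s, t)) = f s * (LINT t:{..<s}|lborel. g t)" for s
  proof -
    have "(\<lambda>t. h2 (s, t)) = (\<lambda>t. f s * indicator {..<s} t *\<^sub>R g t)"
      by (auto simp: h2_def h_def A_def indicator_def fun_eq_iff space_pair_measure)
    then show ?thesis
      by (simp only: set_lebesgue_integral_def integral_mult_left_zero integral_mult_right_zero)
  qed
  have h1': "integrable (lborel \<Otimes>\<^sub>M lborel) (case_prod (\<lambda>s t. h1 (s, t)))"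
    using h1 by simp
  show ?i1
    using lborel_pair.integrable_snd[OF h1'] by (simp add: e1)
  show ?i2
    using lborel_pair.integrable_fst'[OF h2] by (simp add: e2)
  have "(LINT s|lborel. LINT t|lborel. h (s, t)) = (LINT s|lborel. f s) * (LINT t|lborel. g t)"
    by (simp add: h_def)
  then show ?eq
    using lborel_pair.integral_fst'[OF h] lborel_pair.integral_snd[OF h1'] lborel_pair.integral_fst'[OF h2] hsum by (simp add: e1 e2)
qed

lemma lebesgue_integral_borel_version:
  fixes f :: "real \<Rightarrow> complex"
  assumes f: "integrable lebesgue f" and f': "integrable lborel f'"
    and ae: "AE x in lborel. f x = f' x" and A: "A \<in> sets borel"
  shows "(LINT x:A|lborel. f' x) = (LINT x:A|lebesgue. f x)"
proof -
  have m: "(\<lambda>x. indicat_real A x *\<^sub>R f' x) \<in> borel_measurable lborel"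
    using borel_measurable_integrable[OF f'] A by measurable
  have A': "A \<in> sets lebesgue"
    using A by (simp add: sets_completionI_sets)
  have "(LINT x:A|lebesgue. f x) = (LINT x:A|lebesgue. f' x)"
    unfolding set_lebesgue_integral_def
  proof (rule integral_cong_AE)
    show "(\<lambda>x. indicat_real A x *\<^sub>R f x) \<in> borel_measurable lebesgue"
      using borel_measurable_integrable[OF f] A' by measurable
    show "(\<lambda>x. indicat_real A x *\<^sub>R f' x) \<in> borel_measurable lebesgue"
      using m by (rule measurable_completion)
    show "AE x in lebesgue. indicat_real A x *\<^sub>R f x = indicat_real A x *\<^sub>R f' x"
      using AE_completion[OF ae] by eventually_elim simp
  qed
  then show ?thesis
    using m by (simp add: set_lebesgue_integral_def integral_completion)
qed

lemma lborel_integral_lessThan_eq_atMost: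
  fixes f :: "real \<Rightarrow> complex"
  assumes "f \<in> borel_measurable lborel"
  shows "(LINT x:{..<a}|lborel. f x) = (LINT x:{..a}|lborel. f x)"
  unfolding set_lebesgue_integral_def
proof (rule integral_cong_AE)
  show "AE x in lborel. indicator {..<a} x *\<^sub>R f x = indicator {..a} x *\<^sub>R f x"
    using AE_lborel_singleton[of a] by eventually_elim (auto simp: indicator_def)
qed (use assms in measurable)

text \<open>Fubini on the two triangles into which the diagonal divides $[a,b]^2$.\<close>

lemma integral_by_parts_aux:
  fixes f g :: "real \<Rightarrow> complex"
  assumes f: "set_integrable lebesgue {a..b} f" and g: "set_integrable lebesgue {a..b} g"
  shows "set_integrable lebesgue {a..b} (\<lambda>x. integral {a..x} f * g x + f x * integral {a..x} g)"
    and "integral {a..b} (\<lambda>x. integral {a..x} f * g x + f x * integral {a..x} g)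
         = integral {a..b} f * integral {a..b} g"
proof -
  \<comment> \<open>After extension by 0 outside [a, b], integrals over \<open>{..t}\<close> become
    integrals from a to t, and the plane replaces the square.\<close>
  define f0 where "f0 x = indicat_real {a..b} x *\<^sub>R f x" for x
  define g0 where "g0 x = indicat_real {a..b} x *\<^sub>R g x" for x
  have f0: "integrable lebesgue f0" and g0: "integrable lebesgue g0"
    using f g by (simp_all add: set_integrable_def f0_def[abs_def] g0_def[abs_def])
  obtain f' where f': "integrable lborel f'" and fae: "AE x in lborel. f0 x = f' x"
    using lebesgue_integrable_borel_version[OF f0] by blast
  obtain g' where g': "integrable lborel g'" and gae: "AE x in lborel. g0 x = g' x"
    using lebesgue_integrable_borel_version[OF g0] by blast
  have F: "(LINT s:{..t}|lborel. h' s) = integral {a..t} h"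
    if "set_integrable lebesgue {a..b} h" "integrable lebesgue (\<lambda>x. indicat_real {a..b} x *\<^sub>R h x)"
      "integrable lborel h'" "AE x in lborel. indicat_real {a..b} x *\<^sub>R h x = h' x" "t \<in> {a..b}"
    for h h' :: "real \<Rightarrow> complex" and t
  proof -
    have "(LINT s:{..t}|lborel. h' s) = (LINT s:{..t}|lebesgue. indicat_real {a..b} s *\<^sub>R h s)"
      by (rule lebesgue_integral_borel_version) (use that in auto)
    also have "\<dots> = (LINT s:{a..t}|lebesgue. h s)"
      unfolding set_lebesgue_integral_def using that(5)
      by (intro Bochner_Integration.integral_cong) (auto simp: indicator_def)
    also have "\<dots> = integral {a..t} h"
      using that(5) by (intro set_lebesgue_integral_eq_integral set_integrable_subset[OF that(1)]) auto
    finally show ?thesis .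
  qed
  have UN: "(LINT s|lborel. h' s) = integral {a..b} h"
    if "set_integrable lebesgue {a..b} h" "integrable lebesgue (\<lambda>x. indicat_real {a..b} x *\<^sub>R h x)"
      "integrable lborel h'" "AE x in lborel. indicat_real {a..b} x *\<^sub>R h x = h' x"
    for h h' :: "real \<Rightarrow> complex"
  proof -
    have "(LINT s:UNIV|lborel. h' s) = (LINT s:UNIV|lebesgue. indicat_real {a..b} s *\<^sub>R h s)"
      by (rule lebesgue_integral_borel_version) (use that in auto)
    also have "\<dots> = (LINT s:{a..b}|lebesgue. h s)"
      by (simp add: set_lebesgue_integral_def)
    also have "\<dots> = integral {a..b} h"
      by (intro set_lebesgue_integral_eq_integral that(1))
    finally show ?thesis
      by (simp add: set_lebesgue_integral_def)
  qed
  note Ff = F[OF f f0[unfolded f0_def] f' fae[unfolded f0_def]]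
  note Fg = F[OF g g0[unfolded g0_def] g' gae[unfolded g0_def]]
  have [measurable]: "f' \<in> borel_measurable lborel" "g' \<in> borel_measurable lborel"
    using f' g' by auto
  define k where "k t = (LINT s:{..t}|lborel. f' s) * g' t + f' t * (LINT s:{..t}|lborel. g' s)" for t
  \<comment> \<open>A single point is null, so the strict half line of the second triangle may be
    closed; both inner integrals then have the same form.\<close>
  note tri = lborel_integral_triangles[OF f' g', unfolded lborel_integral_lessThan_eq_atMost[OF \<open>g' \<in> borel_measurable lborel\<close>]]
  have k: "integrable lborel k"
    unfolding k_def by (rule Bochner_Integration.integrable_add[OF tri(1,2)])
  have kint: "integral\<^sup>L lborel k = integral {a..b} f * integral {a..b} g"
    unfolding k_def Bochner_Integration.integral_add[OF tri(1,2)] tri(3)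
      UN[OF f f0[unfolded f0_def] f' fae[unfolded f0_def]]
      UN[OF g g0[unfolded g0_def] g' gae[unfolded g0_def]] ..
  define l where "l x = indicat_real {a..b} x *\<^sub>R (integral {a..x} f * g x + f x * integral {a..x} g)" for x
  have ae: "AE x in lebesgue. k x = l x"
    using AE_completion[OF fae] AE_completion[OF gae]
  proof eventually_elim
    case (elim x)
    show ?case
    proof (cases "x \<in> {a..b}")
      case True
      then show ?thesis
        using elim Ff[OF True] Fg[OF True] by (simp add: k_def l_def f0_def g0_def)
    next
      case False
      then have "f' x = 0" "g' x = 0" "l x = 0"
        using elim by (simp_all add: f0_def g0_def l_def)
      then show ?thesis
        by (simp add: k_def)
    qed
  qed
  have kl: "integrable lebesgue k"
    using k by (simp add: integrable_completion)
  have km: "k \<in> borel_measurable lebesgue"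
    using kl by (rule borel_measurable_integrable)
  have lm: "l \<in> borel_measurable lebesgue"
    by (rule borel_measurable_AE[OF km ae])
  have l: "integrable lebesgue l"
    by (rule integrable_cong_AE_imp[OF kl lm ae])
  have "integral\<^sup>L lebesgue l = integral\<^sup>L lebesgue k"
    using integral_cong_AE[OF km lm ae] by simp
  then have lint: "integral\<^sup>L lebesgue l = integral {a..b} f * integral {a..b} g"
    using k kint by (simp add: integral_completion)
  from l show si: "set_integrable lebesgue {a..b} (\<lambda>x. integral {a..x} f * g x + f x * integral {a..x} g)"
    by (simp add: set_integrable_def l_def[abs_def])
  from set_lebesgue_integral_eq_integral(2)[OF si] lint
  show "integral {a..b} (\<lambda>x. integral {a..x} f * g x + f x * integral {a..x} g)
         = integral {a..b} f * integral {a..b} g"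
    by (simp add: set_lebesgue_integral_def l_def[abs_def])
qed

section \<open>The du Bois-Reymond lemma\<close>

text \<open>The Borel sets over which the function integrates to 0 include the intervals and are
  closed under complements and countable disjoint unions, hence are all Borel sets; a density with
  this property vanishes almost everywhere. Complements require a total integral, so the function is
  cut off to [-n, n] and the exceptional sets are collected over all n.\<close>

lemma AE_zero_of_integrals_zero:
  fixes h :: "real \<Rightarrow> complex"
  assumes h: "locally_integrable h" and zero: "\<And>a b. a \<le> b \<Longrightarrow> integral {a..b} h = 0"
  shows "AE x in lebesgue. h x = 0"
proof -
  have "AE x in lebesgue. indicat_real {-real n..real n} x *\<^sub>R h x = 0" for n
  proof -
    define k where "k x = indicat_real {-real n..real n} x *\<^sub>R h x" for x
    have k: "integrable lebesgue k"
      using h by (simp add: locally_integrable_def set_integrable_def k_def[abs_def])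
    obtain k' where k': "integrable lborel k'" and ae: "AE x in lborel. k x = k' x"
      using lebesgue_integrable_borel_version[OF k] by blast
    have [measurable]: "k' \<in> borel_measurable lborel"
      using k' by simp
    have si: "set_integrable lborel A k'" if "A \<in> sets borel" for A
      using k' that by (auto simp: set_integrable_def intro!: integrable_mult_indicator)
    have int: "(LINT x:{a..b}|lborel. k' x) = 0" for a b
    proof -
      have "(LINT x:{a..b}|lborel. k' x) = (LINT x:{a..b}|lebesgue. k x)"
        by (rule lebesgue_integral_borel_version[OF k k' ae]) simp
      also have "\<dots> = (LINT x:{max a (-real n)..min b (real n)}|lebesgue. h x)"
        unfolding set_lebesgue_integral_def k_def
        by (intro Bochner_Integration.integral_cong) (auto simp: indicator_def)
      also have "\<dots> = integral {max a (-real n)..min b (real n)} h"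
        using h by (intro set_lebesgue_integral_eq_integral) (simp add: locally_integrable_def)
      also have "\<dots> = 0"
        using zero by (cases "max a (-real n) \<le> min b (real n)") auto
      finally show ?thesis .
    qed
    have UN: "(LINT x|lborel. k' x) = 0"
    proof -
      have "(LINT x:UNIV|lborel. k' x) = (LINT x:UNIV|lebesgue. k x)"
        by (rule lebesgue_integral_borel_version[OF k k' ae]) simp
      also have "\<dots> = (LINT x:{-real n..real n}|lebesgue. h x)"
        by (simp add: set_lebesgue_integral_def k_def)
      also have "\<dots> = integral {-real n..real n} h"
        using h by (intro set_lebesgue_integral_eq_integral) (simp add: locally_integrable_def)
      also have "\<dots> = 0"
        using zero by simp
      finally show ?thesis
        by (simp add: set_lebesgue_integral_def)
    qed
    have "(LINT x:A|lborel. k' x) = 0" if "A \<in> sets borel" for A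
      using that
    proof (induction A rule: borel_set_induct)
      case (compl A)
      have "(LINT x:A \<union> -A|lborel. k' x) = (LINT x:A|lborel. k' x) + (LINT x:-A|lborel. k' x)"
        using compl by (intro set_integral_Un si) (auto simp: borel_comp)
      then show ?case
        using UN compl by (simp add: set_lebesgue_integral_def)
    next
      case (union f)
      have "(LINT x:(\<Union>i. f i)|lborel. k' x) = (\<Sum>i. LINT x:f i|lborel. k' x)"
        using union by (intro lebesgue_integral_countable_add si) (auto simp: disjoint_family_on_def)
      then show ?case
        using union by simp
    qed (auto simp: int set_lebesgue_integral_def[of _ "{}"])
    then have "AE x in lborel. k' x = 0"
      by (intro sigma_finite_measure.density_zero[OF sigma_finite_lborel k']) simp
    then have "AE x in lborel. k x = 0"
      using ae by eventually_elim simp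
    then show ?thesis
      unfolding k_def by (rule AE_completion)
  qed
  then have "AE x in lebesgue. \<forall>n. indicat_real {-real n..real n} x *\<^sub>R h x = 0"
    unfolding AE_all_countable by blast
  then show ?thesis
  proof eventually_elim
    case (elim x)
    obtain n where "\<bar>x\<bar> \<le> real n"
      using real_arch_simple by blast
    then show ?case
      using elim[rule_format, of n] by (auto simp: indicator_def)
  qed
qed

section \<open>Local integrability and pairing with test functions\<close>

lemma continuous_mult_integrable_on_interval:
  fixes f h :: "real \<Rightarrow> complex"
  assumes "set_integrable lebesgue {a..b} h" and "continuous_on {a..b} f"
  shows "set_integrable lebesgue {a..b} (\<lambda>x. f x * h x)"
proof (rule absolutely_integrable_bounded_measurable_product[OF bilinear_times])
  show "f \<in> borel_measurable (lebesgue_on {a..b})"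
    using assms(2) by (intro continuous_imp_measurable_on_sets_lebesgue) auto
  show "bounded (f ` {a..b})"
    using assms(2) by (intro compact_imp_bounded compact_continuous_image) auto
qed (use assms in auto)

lemma locally_integrable_mult_continuous:
  assumes "locally_integrable h" "continuous_on UNIV f"
  shows "locally_integrable (\<lambda>x. f x * h x)"
  using assms unfolding locally_integrable_def
  by (auto intro!: continuous_mult_integrable_on_interval intro: continuous_on_subset)

lemma locally_integrable_continuous:
  "continuous_on UNIV f \<Longrightarrow> locally_integrable f"
  unfolding locally_integrable_def
  by (auto intro!: absolutely_integrable_continuous_real intro: continuous_on_subset)

lemma locally_integrable_diff:
  "locally_integrable f \<Longrightarrow> locally_integrable g \<Longrightarrow> locally_integrable (\<lambda>x. f x - g x)"
  unfolding locally_integrable_def by auto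

lemma locally_integrable_add:
  "locally_integrable f \<Longrightarrow> locally_integrable g \<Longrightarrow> locally_integrable (\<lambda>x. f x + g x)"
  unfolding locally_integrable_def by auto

text \<open>Weak derivatives are formulated with Lebesgue integrals over the line, indefinite
  integrals with gauge integrals over intervals. Bounded support lets one pass between the
  two.\<close>

lemma integral_eq_LINT_of_support:
  fixes f :: "real \<Rightarrow> complex"
  assumes "set_integrable lebesgue {a..b} f" "\<And>x. x \<notin> {a..b} \<Longrightarrow> f x = 0"
  shows "integrable lebesgue f" "(LINT x|lebesgue. f x) = integral {a..b} f"
proof -
  have *: "indicat_real {a..b} x *\<^sub>R f x = f x" for x
    using assms(2)[of x] by (auto simp: indicator_def)
  then show "integrable lebesgue f"
    using assms(1) by (simp only: set_integrable_def)
  show "(LINT x|lebesgue. f x) = integral {a..b} f"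
    using set_lebesgue_integral_eq_integral(2)[OF assms(1)] *
    by (simp only: set_lebesgue_integral_def)
qed

lemma smooth_continuous: "smooth f \<Longrightarrow> continuous_on S f"
  using smooth_DERIV DERIV_isCont continuous_at_imp_continuous_on by blast

lemma deriv_eq_0_outside_support:
  fixes \<phi> :: "real \<Rightarrow> real"
  assumes "\<And>x. \<bar>x\<bar> \<ge> M \<Longrightarrow> \<phi> x = 0" "\<bar>x\<bar> > M"
  shows "deriv \<phi> x = 0"
proof -
  have "open {x :: real. \<bar>x\<bar> > M}"
    by (intro open_Collect_less continuous_intros)
  then have "\<forall>\<^sub>F y in nhds x. \<phi> y = 0"
    using assms by (auto elim!: eventually_mono[OF eventually_nhds_in_open])
  then have "deriv \<phi> x = deriv (\<lambda>_. 0) x"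
    by (rule deriv_cong_ev) simp
  then show ?thesis by simp
qed

lemma test_fun_mult_integrable:
  assumes "locally_integrable h" "\<phi> \<in> test_fun"
  shows "integrable lebesgue (\<lambda>x. h x * of_real (\<phi> x))"
proof -
  obtain M where M: "smooth \<phi>" "M > 0" "\<And>x. \<bar>x\<bar> \<ge> M \<Longrightarrow> \<phi> x = 0"
    using assms(2) by (elim test_funE) blast
  have "set_integrable lebesgue {-M..M} (\<lambda>x. of_real (\<phi> x) * h x)"
    using assms(1) M(1)
    by (intro continuous_mult_integrable_on_interval continuous_intros smooth_continuous)
       (auto simp: locally_integrable_def)
  then have "set_integrable lebesgue {-M..M} (\<lambda>x. h x * of_real (\<phi> x))"
    by (simp add: mult.commute)
  then show ?thesis
    by (rule integral_eq_LINT_of_support) (use M(3) in auto)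
qed

text \<open>Testing against the bumps of (a, b) and letting them increase to its indicator, with |h|
  on [a, b] as dominating function, shows that h integrates to 0 over every interval.\<close>

lemma fundamental_lemma_calculus_of_variations:
  assumes h: "locally_integrable h"
    and zero: "\<And>\<phi>. \<phi> \<in> test_fun \<Longrightarrow> (LINT x|lebesgue. h x * of_real (\<phi> x)) = 0"
  shows "AE x in lebesgue. h x = 0"
proof (rule AE_zero_of_integrals_zero[OF h])
  fix a b :: real assume "a \<le> b"
  have si: "set_integrable lebesgue {a..b} h"
    using h by (simp add: locally_integrable_def)
  have i1: "integrable lebesgue (\<lambda>x. indicat_real {a..b} x *\<^sub>R norm (h x))"
    using set_integrable_norm[OF si] by (simp add: set_integrable_def)
  have i2: "set_integrable lebesgue {a<..<b} h"
    by (rule set_integrable_subset[OF si]) auto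
  have "(\<lambda>n. LINT x|lebesgue. h x * of_real (bump a b n x)) \<longlonglongrightarrow> (LINT x|lebesgue. indicat_real {a<..<b} x *\<^sub>R h x)"
  proof (rule integral_dominated_convergence[OF _ _ i1])
    show "(\<lambda>x. indicat_real {a<..<b} x *\<^sub>R h x) \<in> borel_measurable lebesgue"
      using i2 unfolding set_integrable_def by (rule borel_measurable_integrable)
    show "(\<lambda>x. h x * of_real (bump a b n x)) \<in> borel_measurable lebesgue" for n
      by (intro borel_measurable_integrable test_fun_mult_integrable h bump_test_fun)
    show "AE x in lebesgue. norm (h x * of_real (bump a b n x)) \<le> indicat_real {a..b} x *\<^sub>R norm (h x)" for n
    proof (rule AE_I2)
      fix x
      show "norm (h x * of_real (bump a b n x)) \<le> indicat_real {a..b} x *\<^sub>R norm (h x)"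
        using bump_le_1[of a b n x] bump_nonneg[of a b n x] bump_eq_0[of x a b n]
        by (cases "x \<in> {a<..<b}") (auto simp: norm_mult mult_left_le)
    qed
    show "AE x in lebesgue. (\<lambda>n. h x * of_real (bump a b n x)) \<longlonglongrightarrow> indicat_real {a<..<b} x *\<^sub>R h x"
    proof (rule AE_I2)
      fix x
      have "(\<lambda>n. h x * of_real (bump a b n x)) \<longlonglongrightarrow> h x * of_real (indicator {a<..<b} x)"
        by (intro tendsto_intros bump_tendsto)
      then show "(\<lambda>n. h x * of_real (bump a b n x)) \<longlonglongrightarrow> indicat_real {a<..<b} x *\<^sub>R h x"
        by (simp add: scaleR_conv_of_real mult.commute)
    qed
  qed
  then have "(LINT x|lebesgue. indicat_real {a<..<b} x *\<^sub>R h x) = 0"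
    by (simp add: zero bump_test_fun LIMSEQ_const_iff)
  then have "integral {a<..<b} h = 0"
    using set_lebesgue_integral_eq_integral(2)[OF i2] by (simp add: set_lebesgue_integral_def)
  then show "integral {a..b} h = 0"
    using integral_open_interval_real[of a b h] by simp
qed

lemma test_fun_comb:
  assumes "\<phi> \<in> test_fun" "\<psi> \<in> test_fun"
  shows "(\<lambda>x. \<phi> x + c * \<psi> x) \<in> test_fun"
proof -
  obtain M where M: "smooth \<phi>" "M > 0" "\<And>x. \<bar>x\<bar> \<ge> M \<Longrightarrow> \<phi> x = 0"
    using assms(1) by (elim test_funE) blast
  obtain N where N: "smooth \<psi>" "N > 0" "\<And>x. \<bar>x\<bar> \<ge> N \<Longrightarrow> \<psi> x = 0"
    using assms(2) by (elim test_funE) blast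
  show ?thesis
  proof (rule test_funI[of _ "- max M N" "max M N"])
    show "smooth (\<lambda>x. \<phi> x + c * \<psi> x)"
      by (intro smooth_add smooth_mult smooth_const M N)
    fix x assume "x \<notin> {- max M N..max M N}"
    then show "\<phi> x + c * \<psi> x = 0"
      using M(3)[of x] N(3)[of x] by auto
  qed
qed

lemma test_fun_integrable:
  assumes "\<phi> \<in> test_fun"
  shows "integrable lebesgue \<phi>"
proof -
  have "integrable lebesgue (\<lambda>x. 1 * complex_of_real (\<phi> x))"
    using assms by (intro test_fun_mult_integrable locally_integrable_continuous continuous_intros)
  then show ?thesis
    by (simp add: complex_of_real_integrable_eq)
qed

text \<open>Fix a test function \<open>\<phi>\<^sub>0\<close> of integral 1. Every test function
  differs from a multiple of it by one of mean zero, that is, by the derivative of a test function,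
  on which h vanishes by assumption. Hence h acts on test functions as the constant c, its pairing
  with \<open>\<phi>\<^sub>0\<close>, and the fundamental lemma applies to h - c.\<close>

lemma du_Bois_Reymond:
  assumes h: "locally_integrable h"
    and zero: "\<And>\<phi>. \<phi> \<in> test_fun \<Longrightarrow> (LINT x|lebesgue. h x * of_real (deriv \<phi> x)) = 0"
  obtains c where "AE x in lebesgue. h x = c"
proof -
  define I where "I = (LINT x|lebesgue. bump 0 1 1 x)"
  have "I \<noteq> 0"
  proof
    assume "I = 0"
    moreover have "integrable lebesgue (bump 0 1 1)"
      by (intro test_fun_integrable bump_test_fun)
    ultimately have "AE x in lebesgue. bump 0 1 1 x = 0"
      using integral_nonneg_eq_0_iff_AE[of lebesgue "bump 0 1 1"] by (simp add: I_def bump_nonneg)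
    then have "AE x in lebesgue. x \<notin> {0<..<1::real}"
      by eventually_elim (use bump_pos[of _ 0 1 1] in force)
    then have "emeasure lebesgue {0<..<1::real} = 0"
      by (subst (asm) AE_iff_measurable[where N = "{0<..<1}"]) auto
    then show False by simp
  qed
  define \<phi>\<^sub>0 where "\<phi>\<^sub>0 x = bump 0 1 1 x / I" for x
  have \<phi>\<^sub>0: "\<phi>\<^sub>0 \<in> test_fun"
    \<comment> \<open>The coefficient makes the combination of the bump with itself equal to 1 +
      (1/I - 1) = 1/I times the bump.\<close>
    using test_fun_comb[OF bump_test_fun bump_test_fun, of 0 1 1 "1 / I - 1" 0 1 1]
    by (simp add: \<phi>\<^sub>0_def[abs_def] algebra_simps)
  have int1: "(LINT x|lebesgue. \<phi>\<^sub>0 x) = 1"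
    using \<open>I \<noteq> 0\<close> by (simp add: \<phi>\<^sub>0_def I_def)
  define c where "c = (LINT x|lebesgue. h x * of_real (\<phi>\<^sub>0 x))"
  have lc: "locally_integrable (\<lambda>x. h x - c)"
    by (intro locally_integrable_diff h locally_integrable_continuous continuous_intros)
  have "AE x in lebesgue. h x - c = 0"
  proof (rule fundamental_lemma_calculus_of_variations[OF lc])
    fix \<phi> assume \<phi>: "\<phi> \<in> test_fun"
    define J where "J = (LINT x|lebesgue. \<phi> x)"
    note i = test_fun_integrable[OF \<phi>] test_fun_integrable[OF \<phi>\<^sub>0]
      test_fun_mult_integrable[OF h \<phi>] test_fun_mult_integrable[OF h \<phi>\<^sub>0]
    have "(\<lambda>x. \<phi> x + (- J) * \<phi>\<^sub>0 x) \<in> test_fun"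
      by (rule test_fun_comb[OF \<phi> \<phi>\<^sub>0])
    moreover have "(LINT x|lebesgue. \<phi> x + (- J) * \<phi>\<^sub>0 x) = 0"
      using i int1 by (simp add: J_def)
    ultimately obtain \<Phi> where "\<Phi> \<in> test_fun" "deriv \<Phi> = (\<lambda>x. \<phi> x + (- J) * \<phi>\<^sub>0 x)"
      by (rule test_fun_antideriv)
    then have "0 = (LINT x|lebesgue. h x * of_real (\<phi> x + (- J) * \<phi>\<^sub>0 x))"
      using zero by metis
    also have "\<dots> = (LINT x|lebesgue. h x * of_real (\<phi> x) - of_real J * (h x * of_real (\<phi>\<^sub>0 x)))"
      by (simp add: algebra_simps)
    also have "\<dots> = (LINT x|lebesgue. h x * of_real (\<phi> x)) - of_real J * c"
      using i by (simp add: c_def)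
    finally have "(LINT x|lebesgue. h x * of_real (\<phi> x)) = of_real J * c" by simp
    moreover have "(LINT x|lebesgue. c * of_real (\<phi> x)) = c * of_real J"
      by (simp add: J_def)
    moreover have "integrable lebesgue (\<lambda>x. c * of_real (\<phi> x))"
      using i(1) by (intro integrable_mult_right) (simp add: complex_of_real_integrable_eq)
    then have "(LINT x|lebesgue. h x * of_real (\<phi> x) - c * of_real (\<phi> x))
        = (LINT x|lebesgue. h x * of_real (\<phi> x)) - (LINT x|lebesgue. c * of_real (\<phi> x))"
      using i(3) by (intro Bochner_Integration.integral_diff)
    ultimately show "(LINT x|lebesgue. (h x - c) * of_real (\<phi> x)) = 0"
      by (simp only: left_diff_distrib) (simp add: mult.commute)
  qed
  then show thesis
    by (intro that[of c]) (auto elim: eventually_mono)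
qed

section \<open>Weak derivatives and indefinite integrals\<close>

text \<open>Local absolute continuity with derivative g, expressed by integrals alone. Nothing is
  asked of u at single points, and g is determined only up to null sets, just like a weak
  derivative.\<close>

definition indef_integral :: "(real \<Rightarrow> complex) \<Rightarrow> (real \<Rightarrow> complex) \<Rightarrow> bool" where
  "indef_integral u g \<longleftrightarrow>
     locally_integrable g \<and> (\<forall>a b. a \<le> b \<longrightarrow> u b - u a = integral {a..b} g)"

lemma locally_integrable_imp_integrable_on:
  "locally_integrable g \<Longrightarrow> g integrable_on {a..b}"
  unfolding locally_integrable_def using set_lebesgue_integral_eq_integral(1) by blast

lemma indef_integral_exists:
  assumes "locally_integrable g"
  shows "\<exists>u. indef_integral u g"
proof -
  define u where "u x = (if x \<ge> 0 then integral {0..x} g else - integral {x..0} g)" for x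
  have "u b - u a = integral {a..b} g" if "a \<le> b" for a b
  proof -
    note comb = Henstock_Kurzweil_Integration.integral_combine
      [OF _ _ locally_integrable_imp_integrable_on[OF assms]]
    consider "0 \<le> a" | "a < 0" "0 \<le> b" | "b < 0"
      by linarith
    then show ?thesis
    proof cases
      case 1
      then show ?thesis
        using that comb[of 0 a b] by (simp add: u_def algebra_simps)
    next
      case 2
      then show ?thesis
        using that comb[of a 0 b] by (simp add: u_def algebra_simps)
    next
      case 3
      then show ?thesis
        using that comb[of a b 0] by (simp add: u_def algebra_simps)
    qed
  qed
  then show ?thesis
    using assms by (auto simp: indef_integral_def)
qed

lemma indef_integral_diff_eq:
  assumes "indef_integral u g" "a \<le> b"
  shows "u b - u a = integral {a..b} g"
  using assms by (simp add: indef_integral_def)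

lemma indef_integral_add_const: "indef_integral u g \<Longrightarrow> indef_integral (\<lambda>x. u x + c) g"
  by (simp add: indef_integral_def)

lemma indef_integral_continuous:
  assumes "indef_integral u g"
  shows "continuous_on S u"
proof -
  have "isCont u x" for x
  proof -
    have "continuous_on {x-1..x+1} (\<lambda>y. u (x-1) + integral {x-1..y} g)"
      using assms
      by (intro continuous_intros indefinite_integral_continuous_1 locally_integrable_imp_integrable_on)
         (simp add: indef_integral_def)
    moreover have "u (x-1) + integral {x-1..y} g = u y" if "y \<in> {x-1..x+1}" for y
      using indef_integral_diff_eq[OF assms, of "x-1" y] that by (simp add: algebra_simps)
    ultimately have "continuous_on {x-1..x+1} u"
      by (rule continuous_on_eq)
    then have "continuous_on {x-1<..<x+1} u"
      by (rule continuous_on_subset) auto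
    then show ?thesis
      by (simp add: continuous_on_eq_continuous_at)
  qed
  then show ?thesis
    using continuous_at_imp_continuous_on by blast
qed

text \<open>On [a, b] write u = u(a) + G and v = v(a) + K with G and K vanishing at a. The product G
  K is the integration by parts over the square; the terms with constants are linear in g and
  k.\<close>

lemma indef_integral_mult:
  assumes u: "indef_integral u g" and v: "indef_integral v k"
  shows "indef_integral (\<lambda>x. u x * v x) (\<lambda>x. u x * k x + g x * v x)"
proof -
  have g: "locally_integrable g" and k: "locally_integrable k"
    using u v by (simp_all add: indef_integral_def)
  have "locally_integrable (\<lambda>x. u x * k x + v x * g x)"
    by (intro locally_integrable_add locally_integrable_mult_continuous g k
        indef_integral_continuous[OF u] indef_integral_continuous[OF v])
  then have loc: "locally_integrable (\<lambda>x. u x * k x + g x * v x)"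
    by (simp add: mult.commute)
  moreover have "u b * v b - u a * v a = integral {a..b} (\<lambda>x. u x * k x + g x * v x)" if "a \<le> b" for a b
  proof -
    let ?G = "\<lambda>x. integral {a..x} g" and ?K = "\<lambda>x. integral {a..x} k"
    have ga: "set_integrable lebesgue {a..b} g" and ka: "set_integrable lebesgue {a..b} k"
      using g k by (simp_all add: locally_integrable_def)
    note parts = integral_by_parts_aux[OF ga ka]
    have G: "u x = u a + ?G x" and K: "v x = v a + ?K x" if "x \<in> {a..b}" for x
      using indef_integral_diff_eq[OF u, of a x] indef_integral_diff_eq[OF v, of a x] that
      by (simp_all add: algebra_simps)
    have p: "(\<lambda>x. ?G x * k x + g x * ?K x) integrable_on {a..b}"
      using parts(1) set_lebesgue_integral_eq_integral(1) by blast
    have i1: "(\<lambda>x. u a * k x) integrable_on {a..b}" and i2: "(\<lambda>x. v a * g x) integrable_on {a..b}"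
      by (intro integrable_on_mult_right locally_integrable_imp_integrable_on g k)+
    have "integral {a..b} (\<lambda>x. u x * k x + g x * v x)
        = integral {a..b} (\<lambda>x. (?G x * k x + g x * ?K x) + (u a * k x + v a * g x))"
    proof (rule integral_cong)
      fix x assume "x \<in> {a..b}"
      then show "u x * k x + g x * v x = (?G x * k x + g x * ?K x) + (u a * k x + v a * g x)"
        by (subst G, assumption, subst K, assumption) (simp add: algebra_simps)
    qed
    also have "\<dots> = ?G b * ?K b + (u a * ?K b + v a * ?G b)"
      using parts(2) by (simp only: Henstock_Kurzweil_Integration.integral_add[OF p integrable_add[OF i1 i2]]
          Henstock_Kurzweil_Integration.integral_add[OF i1 i2] integral_mult_right)
    also have "\<dots> = u b * v b - u a * v a"
      using G[of b] K[of b] that by (simp add: algebra_simps)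
    finally show ?thesis by simp
  qed
  ultimately show ?thesis
    by (simp add: indef_integral_def)
qed

lemma indef_integral_cnj:
  assumes "indef_integral u g"
  shows "indef_integral (\<lambda>x. cnj (u x)) (\<lambda>x. cnj (g x))"
  unfolding indef_integral_def
proof (intro conjI allI impI)
  show "locally_integrable (\<lambda>x. cnj (g x))"
    using assms by (simp add: indef_integral_def locally_integrable_def set_integrable_def
        flip: complex_cnj_scaleR)
  fix a b :: real assume "a \<le> b"
  then have "cnj (u b) - cnj (u a) = cnj (integral {a..b} g)"
    using indef_integral_diff_eq[OF assms, of a b] by (simp flip: complex_cnj_diff)
  then show "cnj (u b) - cnj (u a) = integral {a..b} (\<lambda>x. cnj (g x))"
    by (simp add: integral_cnj)
qed

text \<open>The finite exceptional set is meant for the kink of exp(-l|x|) at the origin.\<close>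

lemma indef_integral_of_vector_derivative:
  assumes "\<And>x. x \<notin> S \<Longrightarrow> (u has_vector_derivative g x) (at x)" "finite S"
    and "continuous_on UNIV u" "locally_integrable g"
  shows "indef_integral u g"
  unfolding indef_integral_def
proof (intro conjI allI impI assms(4))
  fix a b :: real assume "a \<le> b"
  then have "(g has_integral (u b - u a)) {a..b}"
    using assms by (intro fundamental_theorem_of_calculus_strong[of S])
      (auto intro: continuous_on_subset)
  then show "u b - u a = integral {a..b} g"
    by (simp add: integral_unique)
qed

lemma indef_integral_AE_unique:
  assumes "indef_integral u g" "indef_integral u k"
  shows "AE x in lebesgue. g x = k x"
proof -
  have l: "locally_integrable g" "locally_integrable k"
    using assms by (simp_all add: indef_integral_def)
  have "AE x in lebesgue. g x - k x = 0"
  proof (rule AE_zero_of_integrals_zero)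
    show "locally_integrable (\<lambda>x. g x - k x)"
      using l by (rule locally_integrable_diff)
    show "integral {a..b} (\<lambda>x. g x - k x) = 0" if "a \<le> b" for a b
      using indef_integral_diff_eq[OF assms(1) that] indef_integral_diff_eq[OF assms(2) that]
        Henstock_Kurzweil_Integration.integral_diff[OF l[THEN locally_integrable_imp_integrable_on]]
      by simp
  qed
  then show ?thesis
    by eventually_elim simp
qed

text \<open>By the product rule, u times the test function increases over [-M, M] by the sum of the
  two integrals, and it is 0 at both ends.\<close>

lemma indef_integral_weak_derivative:
  assumes u: "indef_integral u g" and \<phi>: "\<phi> \<in> test_fun"
  shows "(LINT x|lebesgue. u x * of_real (deriv \<phi> x)) = - (LINT x|lebesgue. g x * of_real (\<phi> x))"
    and "integrable lebesgue (\<lambda>x. u x * of_real (deriv \<phi> x))"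
proof -
  obtain M where M: "smooth \<phi>" "M > 0" "\<And>x. \<bar>x\<bar> \<ge> M \<Longrightarrow> \<phi> x = 0"
    using \<phi> by (elim test_funE) blast
  have g: "locally_integrable g"
    using u by (simp add: indef_integral_def)
  have cu: "continuous_on UNIV u"
    by (rule indef_integral_continuous[OF u])
  have c\<phi>: "continuous_on UNIV (\<lambda>x. complex_of_real (\<phi> x))"
    and cd: "continuous_on UNIV (\<lambda>x. complex_of_real (deriv \<phi> x))"
    by (intro continuous_intros smooth_continuous smooth_deriv M(1))+
  have v: "indef_integral (\<lambda>x. complex_of_real (\<phi> x)) (\<lambda>x. complex_of_real (deriv \<phi> x))"
  proof (rule indef_integral_of_vector_derivative[of "{}"])
    show "((\<lambda>x. complex_of_real (\<phi> x)) has_vector_derivative complex_of_real (deriv \<phi> x)) (at x)" for x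
      using smooth_DERIV[OF M(1), of x]
      by (intro has_vector_derivative_of_real)
         (simp add: has_real_derivative_iff_has_vector_derivative)
  qed (use c\<phi> cd locally_integrable_continuous in auto)
  have l1: "set_integrable lebesgue {-M..M} (\<lambda>x. u x * of_real (deriv \<phi> x))"
    using locally_integrable_continuous[OF continuous_on_mult[OF cu cd]] by (simp add: locally_integrable_def)
  have l2: "set_integrable lebesgue {-M..M} (\<lambda>x. g x * of_real (\<phi> x))"
    using locally_integrable_mult_continuous[OF g c\<phi>] by (simp add: locally_integrable_def mult.commute)
  have z1: "u x * of_real (deriv \<phi> x) = 0" if "x \<notin> {-M..M}" for x
    using deriv_eq_0_outside_support[of M \<phi> x] M that by auto
  have z2: "g x * of_real (\<phi> x) = 0" if "x \<notin> {-M..M}" for x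
  proof -
    have "\<bar>x\<bar> \<ge> M"
      using that by auto
    then show ?thesis
      by (simp add: M(3))
  qed
  show "integrable lebesgue (\<lambda>x. u x * of_real (deriv \<phi> x))"
    by (rule integral_eq_LINT_of_support[OF l1 z1])
  have "0 = integral {-M..M} (\<lambda>x. u x * of_real (deriv \<phi> x) + g x * of_real (\<phi> x))"
    using indef_integral_diff_eq[OF indef_integral_mult[OF u v], of "-M" M] M by simp
  also have "\<dots> = integral {-M..M} (\<lambda>x. u x * of_real (deriv \<phi> x))
      + integral {-M..M} (\<lambda>x. g x * of_real (\<phi> x))"
    using l1 l2 by (intro Henstock_Kurzweil_Integration.integral_add set_lebesgue_integral_eq_integral)
  finally have "integral {-M..M} (\<lambda>x. u x * of_real (deriv \<phi> x)) = - integral {-M..M} (\<lambda>x. g x * of_real (\<phi> x))"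
    by (simp add: eq_neg_iff_add_eq_0)
  moreover have "(LINT x|lebesgue. u x * of_real (deriv \<phi> x)) = integral {-M..M} (\<lambda>x. u x * of_real (deriv \<phi> x))"
    by (rule integral_eq_LINT_of_support[OF l1 z1])
  moreover have "(LINT x|lebesgue. g x * of_real (\<phi> x)) = integral {-M..M} (\<lambda>x. g x * of_real (\<phi> x))"
    by (rule integral_eq_LINT_of_support[OF l2 z2])
  ultimately show "(LINT x|lebesgue. u x * of_real (deriv \<phi> x)) = - (LINT x|lebesgue. g x * of_real (\<phi> x))"
    by simp
qed

text \<open>Any indefinite integral v of g also has weak derivative g, so f - v annihilates all
  derivatives of test functions and is a constant almost everywhere. Adding that constant to v gives
  u.\<close>

lemma weak_derivative_imp_indef_integral:
  assumes "has_weak_derivative f g"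
  obtains u where "indef_integral u g" "AE x in lebesgue. f x = u x"
proof -
  have f: "locally_integrable f" and g: "locally_integrable g"
    and wd: "\<And>\<phi>. \<phi> \<in> test_fun \<Longrightarrow>
      (LINT x|lebesgue. f x * of_real (deriv \<phi> x)) = - (LINT x|lebesgue. g x * of_real (\<phi> x))"
    using assms by (auto simp: has_weak_derivative_def)
  obtain v where v: "indef_integral v g"
    using indef_integral_exists[OF g] by blast
  have loc: "locally_integrable (\<lambda>x. f x - v x)"
    by (intro locally_integrable_diff f locally_integrable_continuous indef_integral_continuous[OF v])
  obtain c where c: "AE x in lebesgue. f x - v x = c"
  proof (rule du_Bois_Reymond[OF loc])
    fix \<phi> assume \<phi>: "\<phi> \<in> test_fun"
    have "deriv \<phi> \<in> test_fun"
    proof -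
      obtain M where M: "smooth \<phi>" "M > 0" "\<And>x. \<bar>x\<bar> \<ge> M \<Longrightarrow> \<phi> x = 0"
        using \<phi> by (elim test_funE) blast
      show ?thesis
        by (rule test_funI[OF smooth_deriv[OF M(1)], of "-M" M])
           (use deriv_eq_0_outside_support[of M \<phi>] M in auto)
    qed
    then have "integrable lebesgue (\<lambda>x. f x * of_real (deriv \<phi> x))"
      by (rule test_fun_mult_integrable[OF f])
    then show "(LINT x|lebesgue. (f x - v x) * of_real (deriv \<phi> x)) = 0"
      using indef_integral_weak_derivative[OF v \<phi>] wd[OF \<phi>] by (simp add: left_diff_distrib)
  qed
  show thesis
  proof (rule that)
    show "indef_integral (\<lambda>x. v x + c) g"
      using v by (rule indef_integral_add_const)
    show "AE x in lebesgue. f x = v x + c"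
      using c by eventually_elim (simp add: algebra_simps)
  qed
qed

text \<open>The set where the two functions differ is open and null, hence empty.\<close>

lemma continuous_AE_eq_imp_eq:
  fixes u v :: "real \<Rightarrow> complex"
  assumes "continuous_on UNIV u" "continuous_on UNIV v" "AE x in lebesgue. u x = v x"
  shows "u = v"
proof -
  have "open {x. u x \<noteq> v x}"
    using assms(1,2) by (intro open_Collect_neq)
  moreover have "negligible {x. u x \<noteq> v x}"
    using assms(3) by (simp add: negligible_iff_null_sets completion.AE_iff_null_sets)
  ultimately have "{x. u x \<noteq> v x} = {}"
    using open_not_negligible by blast
  then show ?thesis by auto
qed

lemma cont_rep_eq:
  assumes "continuous_on UNIV u" "AE x in lebesgue. f x = u x"
  shows "cont_rep f = u"
  unfolding cont_rep_def
proof (rule the_equality)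
  fix v assume "continuous_on UNIV v \<and> (AE x in lebesgue. f x = v x)"
  then have v: "continuous_on UNIV v" and fv: "AE x in lebesgue. f x = v x"
    by auto
  have "AE x in lebesgue. v x = u x"
    using fv assms(2) by eventually_elim simp
  then show "v = u"
    by (rule continuous_AE_eq_imp_eq[OF v assms(1)])
qed (use assms in simp)

section \<open>The trace inequality\<close>

text \<open>An interval of length n on which |f| >= c forces the integral of |f| to be at least c n.
  The intervals may lie anywhere, so that the limits at both ends of the line can be treated
  alike.\<close>

lemma integrable_not_bounded_below:
  fixes f :: "real \<Rightarrow> complex"
  assumes f: "integrable lebesgue f" and "c > 0"
    and long: "\<And>n :: nat. \<exists>a. \<forall>x\<in>{a..a + real n}. norm (f x) \<ge> c"
  shows False
proof -
  obtain n where n: "(LINT x|lebesgue. norm (f x)) / c < real n"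
    using reals_Archimedean2 by blast
  obtain a where a: "\<And>x. x \<in> {a..a + real n} \<Longrightarrow> norm (f x) \<ge> c"
    using long by blast
  have "c * real n = (LINT x|lebesgue. c * indicator {a..a + real n} x)"
    by simp
  also have "\<dots> \<le> (LINT x|lebesgue. norm (f x))"
  proof (rule integral_mono)
    show "integrable lebesgue (\<lambda>x. c * indicat_real {a..a + real n} x)"
      by (intro integrable_mult_right integrable_real_indicator) auto
    show "integrable lebesgue (\<lambda>x. norm (f x))"
      using f by (rule integrable_norm)
    show "c * indicator {a..a + real n} x \<le> norm (f x)" for x
      using a[of x] by (auto simp: indicator_def)
  qed
  finally show False
    using n \<open>c > 0\<close> by (simp add: field_simps)
qed

lemma integrable_tendsto_at_top_imp_0:
  fixes f :: "real \<Rightarrow> complex"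
  assumes "integrable lebesgue f" "(f \<longlongrightarrow> L) at_top"
  shows "L = 0"
proof (rule ccontr)
  assume "L \<noteq> 0"
  then have "norm L / 2 < norm L" "norm L / 2 > 0" by simp_all
  then have "\<forall>\<^sub>F x in at_top. norm L / 2 < norm (f x)"
    by (intro order_tendstoD(1)[OF tendsto_norm[OF assms(2)]])
  then obtain B where B: "\<And>x. x \<ge> B \<Longrightarrow> norm L / 2 < norm (f x)"
    by (auto simp: eventually_at_top_linorder)
  have "\<exists>a. \<forall>x\<in>{a..a + real n}. norm (f x) \<ge> norm L / 2" for n :: nat
    by (rule exI[of _ B]) (use B in \<open>auto intro: less_imp_le\<close>)
  then show False
    using integrable_not_bounded_below[OF assms(1) \<open>norm L / 2 > 0\<close>] by blast
qed

lemma integrable_tendsto_at_bot_imp_0: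
  fixes f :: "real \<Rightarrow> complex"
  assumes "integrable lebesgue f" "(f \<longlongrightarrow> L) at_bot"
  shows "L = 0"
proof (rule ccontr)
  assume "L \<noteq> 0"
  then have "norm L / 2 < norm L" "norm L / 2 > 0" by simp_all
  then have "\<forall>\<^sub>F x in at_bot. norm L / 2 < norm (f x)"
    by (intro order_tendstoD(1)[OF tendsto_norm[OF assms(2)]])
  then obtain B where B: "\<And>x. x \<le> B \<Longrightarrow> norm L / 2 < norm (f x)"
    by (auto simp: eventually_at_bot_linorder)
  have "\<exists>a. \<forall>x\<in>{a..a + real n}. norm (f x) \<ge> norm L / 2" for n :: nat
    by (rule exI[of _ "B - real n"]) (use B in \<open>auto intro: less_imp_le\<close>)
  then show False
    using integrable_not_bounded_below[OF assms(1) \<open>norm L / 2 > 0\<close>] by blast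
qed

section \<open>Square-integrable functions\<close>

lemma L2_measurable: "f \<in> L2 \<Longrightarrow> f \<in> borel_measurable lebesgue"
  and L2_integrable: "f \<in> L2 \<Longrightarrow> integrable lebesgue (\<lambda>x. (cmod (f x))\<^sup>2)"
  by (simp_all add: L2_def)

lemma L2_mult_integrable:
  assumes f: "f \<in> L2" and g: "g \<in> L2"
  shows "integrable lebesgue (\<lambda>x. f x * g x)"
proof (rule Bochner_Integration.integrable_bound)
  show "integrable lebesgue (\<lambda>x. (cmod (f x))\<^sup>2 + (cmod (g x))\<^sup>2)"
    by (intro Bochner_Integration.integrable_add L2_integrable f g)
  show "(\<lambda>x. f x * g x) \<in> borel_measurable lebesgue"
    using L2_measurable[OF f] L2_measurable[OF g] by measurable
  have "cmod (f x) * cmod (g x) \<le> (cmod (f x))\<^sup>2 + (cmod (g x))\<^sup>2" for x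
    using sum_squares_bound[of "cmod (f x)" "cmod (g x)"] mult_nonneg_nonneg[OF norm_ge_zero[of "f x"] norm_ge_zero[of "g x"]]
    by linarith
  then show "AE x in lebesgue. norm (f x * g x) \<le> norm ((cmod (f x))\<^sup>2 + (cmod (g x))\<^sup>2)"
    by (intro AE_I2) (simp add: norm_mult)
qed

lemma L2_cnj: "f \<in> L2 \<Longrightarrow> (\<lambda>x. cnj (f x)) \<in> L2"
  by (simp add: L2_def borel_measurable_complex_iff)

lemma L2_AE_cong:
  assumes "f \<in> L2" "AE x in lebesgue. f x = g x"
  shows "g \<in> L2"
proof -
  have m: "g \<in> borel_measurable lebesgue"
    by (rule borel_measurable_AE[OF L2_measurable[OF assms(1)] assms(2)])
  have "AE x in lebesgue. (cmod (f x))\<^sup>2 = (cmod (g x))\<^sup>2"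
    using assms(2) by eventually_elim simp
  then have "integrable lebesgue (\<lambda>x. (cmod (g x))\<^sup>2)"
    by (intro integrable_cong_AE_imp[OF L2_integrable[OF assms(1)]]) (use m in measurable)
  with m show ?thesis
    by (simp add: L2_def)
qed

lemma L2_norm_AE_cong:
  assumes "f \<in> L2" "AE x in lebesgue. f x = g x"
  shows "L2_norm f = L2_norm g"
proof -
  note m = L2_measurable[OF assms(1)] L2_measurable[OF L2_AE_cong[OF assms]]
  have "(LINT x|lebesgue. (cmod (f x))\<^sup>2) = (LINT x|lebesgue. (cmod (g x))\<^sup>2)"
  proof (rule integral_cong_AE)
    show "AE x in lebesgue. (cmod (f x))\<^sup>2 = (cmod (g x))\<^sup>2"
      using assms(2) by eventually_elim simp
  qed (use m in measurable)
  then show ?thesis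
    by (simp add: L2_norm_def)
qed

lemma L2_norm_power2: "(L2_norm f)\<^sup>2 = (LINT x|lebesgue. (cmod (f x))\<^sup>2)"
  by (simp add: L2_norm_def)

lemma L2_norm_eq_0_imp:
  assumes "f \<in> L2" "L2_norm f = 0"
  shows "AE x in lebesgue. f x = 0"
proof -
  have "(LINT x|lebesgue. (cmod (f x))\<^sup>2) = 0"
    using assms(2) by (simp add: L2_norm_def)
  then have "AE x in lebesgue. (cmod (f x))\<^sup>2 = 0"
    using integral_nonneg_eq_0_iff_AE[OF L2_integrable[OF assms(1)]] by simp
  then show ?thesis
    by eventually_elim simp
qed

text \<open>The density of $|u|^2$ integrates to $-|u(0)|^2$ over the right half line and to
  $|u(0)|^2$ over the left one, because $u$ vanishes at infinity.\<close>

lemma integral_sgn_density: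
  assumes u: "indef_integral u g" and L2: "u \<in> L2" "g \<in> L2"
  defines "Q \<equiv> (\<lambda>x. u x * cnj (g x) + g x * cnj (u x))"
  shows "integrable lebesgue (\<lambda>x. of_real (sgn x) * Q x)"
    and "(LINT x|lebesgue. of_real (sgn x) * Q x) = - 2 * of_real ((cmod (u 0))\<^sup>2)"
proof -
  \<comment> \<open>This is |u|^2, kept complex-valued so that the product rule for indefinite
    integrals applies to it directly.\<close>
  define w where "w x = u x * cnj (u x)" for x
  have w: "indef_integral w Q"
    unfolding w_def[abs_def] Q_def by (rule indef_integral_mult[OF u indef_integral_cnj[OF u]])
  have Q: "integrable lebesgue Q"
    unfolding Q_def by (intro Bochner_Integration.integrable_add L2_mult_integrable L2_cnj L2)
  have wi: "integrable lebesgue w"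
    unfolding w_def[abs_def] by (intro L2_mult_integrable L2_cnj L2)
  have Qs: "set_integrable lebesgue S Q" if "S \<in> sets lebesgue" for S
    using integrable_mult_indicator[OF that Q] by (simp add: set_integrable_def)
  have diff: "w b - w a = (LINT x:{a..b}|lebesgue. Q x)" if "a \<le> b" for a b
    using indef_integral_diff_eq[OF w that] set_lebesgue_integral_eq_integral(2)[OF Qs[of "{a..b}"]] by simp
  \<comment> \<open>Integrability of \<open>Q\<close> guarantees that \<open>w\<close> has a limit
    at infinity; integrability of \<open>w\<close> then forces the limit to be 0.\<close>
  have "((\<lambda>b. w 0 + (LINT x:{0..b}|lebesgue. Q x)) \<longlongrightarrow> w 0 + (LINT x:{0..}|lebesgue. Q x)) at_top"
    by (intro tendsto_intros tendsto_set_lebesgue_integral_at_top Qs) auto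
  then have "(w \<longlongrightarrow> w 0 + (LINT x:{0..}|lebesgue. Q x)) at_top"
  proof (rule Lim_transform_eventually)
    show "\<forall>\<^sub>F b in at_top. w 0 + (LINT x:{0..b}|lebesgue. Q x) = w b"
      using eventually_ge_at_top[of 0] by eventually_elim (simp flip: diff)
  qed
  then have right: "w 0 + (LINT x:{0..}|lebesgue. Q x) = 0"
    by (rule integrable_tendsto_at_top_imp_0[OF wi])
  have "((\<lambda>a. w 0 - (LINT x:{a..0}|lebesgue. Q x)) \<longlongrightarrow> w 0 - (LINT x:{..0}|lebesgue. Q x)) at_bot"
    by (intro tendsto_intros tendsto_set_lebesgue_integral_at_bot Qs) auto
  then have "(w \<longlongrightarrow> w 0 - (LINT x:{..0}|lebesgue. Q x)) at_bot"
  proof (rule Lim_transform_eventually)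
    show "\<forall>\<^sub>F a in at_bot. w 0 - (LINT x:{a..0}|lebesgue. Q x) = w a"
      using eventually_le_at_bot[of 0] by eventually_elim (simp flip: diff)
  qed
  then have left: "w 0 - (LINT x:{..0}|lebesgue. Q x) = 0"
    by (rule integrable_tendsto_at_bot_imp_0[OF wi])
  \<comment> \<open>At x = 0 both indicators equal 1 and cancel, in agreement with
    \<open>sgn 0 = 0\<close>, so the splitting holds at every point.\<close>
  have sgn: "of_real (sgn x) * Q x = indicat_real {0..} x *\<^sub>R Q x - indicat_real {..0} x *\<^sub>R Q x" for x
    by (auto simp: indicator_def sgn_if)
  have i: "integrable lebesgue (\<lambda>x. indicat_real {0..} x *\<^sub>R Q x)"
    "integrable lebesgue (\<lambda>x. indicat_real {..0} x *\<^sub>R Q x)"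
    by (intro integrable_mult_indicator Q; simp)+
  show "integrable lebesgue (\<lambda>x. of_real (sgn x) * Q x)"
    unfolding sgn by (intro Bochner_Integration.integrable_diff i)
  have "(LINT x|lebesgue. of_real (sgn x) * Q x) = (LINT x:{0..}|lebesgue. Q x) - (LINT x:{..0}|lebesgue. Q x)"
    unfolding sgn set_lebesgue_integral_def by (rule Bochner_Integration.integral_diff[OF i])
  also have "\<dots> = - 2 * w 0"
    using left right by (simp add: eq_neg_iff_add_eq_0 algebra_simps)
  also have "w 0 = of_real ((cmod (u 0))\<^sup>2)"
    unfolding w_def by (rule complex_norm_square[symmetric])
  finally show "(LINT x|lebesgue. of_real (sgn x) * Q x) = - 2 * of_real ((cmod (u 0))\<^sup>2)" .
qed

text \<open>Completing the square against the logarithmic derivative $-\lambda\,\mathrm{sgn}$ of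
  the expected extremiser.\<close>

lemma completed_square:
  assumes u: "indef_integral u g" and L2: "u \<in> L2" "g \<in> L2"
  shows "integrable lebesgue (\<lambda>x. (cmod (g x + of_real (l * sgn x) * u x))\<^sup>2)"
    and "(LINT x|lebesgue. (cmod (g x + of_real (l * sgn x) * u x))\<^sup>2)
      = (L2_norm g)\<^sup>2 - 2 * l * (cmod (u 0))\<^sup>2 + l\<^sup>2 * (L2_norm u)\<^sup>2"
proof -
  define Q where "Q x = u x * cnj (g x) + g x * cnj (u x)" for x
  note sd = integral_sgn_density[OF assms, folded Q_def]
  \<comment> \<open>The expanded square with sgn^2 replaced by 1. \<open>Q\<close> takes real
    values, namely 2 Re(u cnj g), so \<open>Re\<close> only changes its type.\<close>
  define R where "R x = (cmod (g x))\<^sup>2 + l * Re (of_real (sgn x) * Q x) + l\<^sup>2 * (cmod (u x))\<^sup>2" for x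
  have R: "integrable lebesgue R"
    unfolding R_def[abs_def]
    by (intro Bochner_Integration.integrable_add integrable_mult_right integrable_Re sd L2_integrable L2)
  have RI: "(LINT x|lebesgue. R x) = (L2_norm g)\<^sup>2 - 2 * l * (cmod (u 0))\<^sup>2 + l\<^sup>2 * (L2_norm u)\<^sup>2"
  proof -
    have "(LINT x|lebesgue. Re (of_real (sgn x) * Q x)) = Re (LINT x|lebesgue. of_real (sgn x) * Q x)"
      by (rule integral_Re[OF sd(1)])
    also have "\<dots> = - 2 * (cmod (u 0))\<^sup>2"
      unfolding sd(2) by simp
    finally have ReI: "(LINT x|lebesgue. Re (of_real (sgn x) * Q x)) = - 2 * (cmod (u 0))\<^sup>2" .
    have i: "integrable lebesgue (\<lambda>x. l * Re (of_real (sgn x) * Q x))"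
      by (intro integrable_mult_right integrable_Re sd)
    have j: "integrable lebesgue (\<lambda>x. l\<^sup>2 * (cmod (u x))\<^sup>2)"
      by (intro integrable_mult_right L2_integrable L2)
    show ?thesis
      unfolding R_def
        Bochner_Integration.integral_add[OF Bochner_Integration.integrable_add[OF L2_integrable[OF L2(2)] i] j]
        Bochner_Integration.integral_add[OF L2_integrable[OF L2(2)] i] integral_mult_right_zero ReI
      by (simp add: L2_norm_power2)
  qed
  \<comment> \<open>The origin is excluded because \<open>sgn 0 = 0\<close> removes the term l^2
    |u|^2 there; one point does not affect the integral.\<close>
  have pt: "(cmod (g x + of_real (l * sgn x) * u x))\<^sup>2 = R x" if "x \<noteq> 0" for x
  proof -
    have "sgn x = 1 \<or> sgn x = -1"
      using that by (auto simp: sgn_if)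
    then show ?thesis
      unfolding R_def Q_def cmod_power2
      by (elim disjE) (simp_all add: power2_eq_square algebra_simps)
  qed
  have "AE x in lebesgue. x \<noteq> (0::real)"
    by (rule AE_completion[OF AE_lborel_singleton])
  then have ae: "AE x in lebesgue. R x = (cmod (g x + of_real (l * sgn x) * u x))\<^sup>2"
    by eventually_elim (rule pt[symmetric])
  have m: "(\<lambda>x. (cmod (g x + of_real (l * sgn x) * u x))\<^sup>2) \<in> borel_measurable lebesgue"
    by (rule borel_measurable_AE[OF borel_measurable_integrable[OF R] ae])
  show "integrable lebesgue (\<lambda>x. (cmod (g x + of_real (l * sgn x) * u x))\<^sup>2)"
    by (rule integrable_cong_AE_imp[OF R m ae])
  show "(LINT x|lebesgue. (cmod (g x + of_real (l * sgn x) * u x))\<^sup>2)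
      = (L2_norm g)\<^sup>2 - 2 * l * (cmod (u 0))\<^sup>2 + l\<^sup>2 * (L2_norm u)\<^sup>2"
    using integral_cong_AE[OF borel_measurable_integrable[OF R] m ae] RI by simp
qed

text \<open>With the integrating factor exp(-m x), the product rule gives u(x) exp(-m x) a density
  that vanishes almost everywhere on [a, b], so its values at a and b agree.\<close>

lemma indef_integral_linear_ode:
  assumes u: "indef_integral u g" and "a \<le> b"
    and ae: "AE x in lebesgue. x \<in> {a..b} \<longrightarrow> g x = of_real m * u x"
  shows "u b = u a * of_real (exp (m * (b - a)))"
proof -
  define e where "e x = complex_of_real (exp (- m * x))" for x
  have ce: "continuous_on UNIV e" and ce': "continuous_on UNIV (\<lambda>x. - of_real m * e x)"
    unfolding e_def by (intro continuous_intros)+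
  have e: "indef_integral e (\<lambda>x. - of_real m * e x)"
  proof (rule indef_integral_of_vector_derivative[of "{}"])
    fix x :: real
    have "((\<lambda>x. exp (- m * x)) has_field_derivative (- m * exp (- m * x))) (at x)"
      by (auto intro!: derivative_eq_intros)
    then have "((\<lambda>x. complex_of_real (exp (- m * x))) has_vector_derivative complex_of_real (- m * exp (- m * x))) (at x)"
      by (intro has_vector_derivative_of_real) (simp add: has_real_derivative_iff_has_vector_derivative)
    then show "(e has_vector_derivative - of_real m * e x) (at x)"
      by (simp add: e_def[abs_def])
  qed (use ce ce' locally_integrable_continuous in auto)
  let ?q = "\<lambda>x. u x * (- of_real m * e x) + g x * e x"
  have "AE x in lborel. x \<in> {a..b} \<longrightarrow> ?q x = 0"
    using ae unfolding AE_completion_iff by eventually_elim (simp add: algebra_simps)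
  then have "(?q has_integral 0) {a..b} \<longleftrightarrow> ((\<lambda>_. 0) has_integral (0::complex)) {a..b}"
    by (rule has_integral_AE)
  then have "integral {a..b} ?q = 0"
    by (simp add: integral_unique)
  then have "u b * e b = u a * e a"
    using indef_integral_diff_eq[OF indef_integral_mult[OF u e] \<open>a \<le> b\<close>] by simp
  then have "u b * (e b * of_real (exp (m * b))) = u a * (e a * of_real (exp (m * b)))"
    by (simp add: mult.assoc[symmetric])
  moreover have "e b * of_real (exp (m * b)) = 1"
    unfolding e_def of_real_mult[symmetric] exp_add[symmetric] by simp
  moreover have "e a * of_real (exp (m * b)) = of_real (exp (m * (b - a)))"
    unfolding e_def of_real_mult[symmetric] exp_add[symmetric] by (simp add: algebra_simps)
  ultimately show ?thesis by simp
qed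

lemma indef_integral_exp_abs:
  assumes u: "indef_integral u g" and ae: "AE x in lebesgue. g x = - of_real (l * sgn x) * u x"
  shows "u x = u 0 * of_real (exp (- l * \<bar>x\<bar>))"
proof -
  have nz: "AE x in lebesgue. x \<noteq> (0::real)"
    by (rule AE_completion[OF AE_lborel_singleton])
  show ?thesis
  proof (cases "x \<ge> 0")
    case True
    have "AE y in lebesgue. y \<in> {0..x} \<longrightarrow> g y = of_real (- l) * u y"
      using ae nz by eventually_elim auto
    from indef_integral_linear_ode[OF u True this] True show ?thesis by simp
  next
    case False
    then have "x \<le> 0" by simp
    \<comment> \<open>The equation is propagated from x up to 0, so it expresses \<open>u 0\<close>
      through \<open>u x\<close> and has to be inverted afterwards.\<close>
    have "AE y in lebesgue. y \<in> {x..0} \<longrightarrow> g y = of_real l * u y"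
      using ae nz by eventually_elim auto
    from indef_integral_linear_ode[OF u \<open>x \<le> 0\<close> this]
    have "u 0 * of_real (exp (l * x)) = u x * of_real (exp (- (l * x)) * exp (l * x))"
      by simp
    also have "\<dots> = u x"
      unfolding exp_add[symmetric] by simp
    finally show ?thesis
      using False by simp
  qed
qed

lemma exp_abs_indef_integral:
  fixes K :: complex and l :: real
  defines "u \<equiv> (\<lambda>x. K * of_real (exp (- l * \<bar>x\<bar>)))"
  shows "indef_integral u (\<lambda>x. - of_real (l * sgn x) * u x)"
proof (rule indef_integral_of_vector_derivative[of "{0}"])
  show cont: "continuous_on UNIV u"
    unfolding u_def by (intro continuous_intros)
  \<comment> \<open>Because \<open>sgn\<close> jumps at 0, the factor is handled as a bounded
    measurable function rather than a continuous one.\<close>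
  have "set_integrable lebesgue {a..b} (\<lambda>x. of_real (- l * sgn x) * u x)" for a b
  proof (rule absolutely_integrable_bounded_measurable_product[OF bilinear_times])
    show "(\<lambda>x. complex_of_real (- l * sgn x)) \<in> borel_measurable (lebesgue_on {a..b})"
    proof -
      have "(\<lambda>x. complex_of_real (- l * sgn x)) \<in> borel_measurable borel"
        by measurable
      then show ?thesis
        by (intro measurable_restrict_space1 measurable_completion) simp
    qed
    show "bounded ((\<lambda>x. complex_of_real (- l * sgn x)) ` {a..b})"
      by (rule boundedI[of _ "\<bar>l\<bar>"]) (auto simp: norm_mult abs_mult sgn_if)
    show "set_integrable lebesgue {a..b} u"
      using locally_integrable_continuous[OF cont] by (simp add: locally_integrable_def)
  qed auto
  then show "locally_integrable (\<lambda>x. - of_real (l * sgn x) * u x)"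
    by (simp add: locally_integrable_def)
  fix x :: real assume "x \<notin> {0}"
  have "((\<lambda>x. \<bar>x\<bar>) has_field_derivative sgn x) (at x)"
  proof (cases "x > 0")
    case True
    have "((\<lambda>x. x) has_field_derivative sgn x) (at x)"
      using True by (auto intro!: derivative_eq_intros)
    then show ?thesis
      by (rule has_field_derivative_transform_within_open[of _ _ _ "{0<..}"]) (use True in auto)
  next
    case False
    with \<open>x \<notin> {0}\<close> have neg: "x < 0" by auto
    have "((\<lambda>x. - x) has_field_derivative sgn x) (at x)"
      using neg by (auto intro!: derivative_eq_intros)
    then show ?thesis
      by (rule has_field_derivative_transform_within_open[of _ _ _ "{..<0}"]) (use neg in auto)
  qed
  then have "((\<lambda>x. exp (- l * \<bar>x\<bar>)) has_field_derivative (exp (- l * \<bar>x\<bar>) * (- l * sgn x))) (at x)"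
    by (intro DERIV_chain2[OF DERIV_exp] DERIV_cmult)
  then have "((\<lambda>x. exp (- l * \<bar>x\<bar>)) has_field_derivative (- (l * sgn x) * exp (- l * \<bar>x\<bar>))) (at x)"
    by (simp add: mult.commute)
  then have "((\<lambda>x. complex_of_real (exp (- l * \<bar>x\<bar>))) has_vector_derivative
      complex_of_real (- (l * sgn x) * exp (- l * \<bar>x\<bar>))) (at x)"
    by (intro has_vector_derivative_of_real) (simp add: has_real_derivative_iff_has_vector_derivative)
  then have "((\<lambda>x. K * complex_of_real (exp (- l * \<bar>x\<bar>))) has_vector_derivative
      K * complex_of_real (- (l * sgn x) * exp (- l * \<bar>x\<bar>))) (at x)"
    by (rule has_vector_derivative_mult_right)
  then show "(u has_vector_derivative - of_real (l * sgn x) * u x) (at x)"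
    by (simp add: u_def algebra_simps)
qed simp

section \<open>The inequality and its equality case for indefinite integrals\<close>

lemma indef_integral_trace_le:
  assumes u: "indef_integral u g" and L2: "u \<in> L2" "g \<in> L2"
  shows "(cmod (u 0))\<^sup>2 \<le> L2_norm u * L2_norm g"
\<comment> \<open>The quadratic in l degenerates when the norm of u is 0; then u vanishes
  identically by continuity, in particular at the origin.\<close>
proof (cases "L2_norm u = 0")
  case True
  then have "AE x in lebesgue. u x = 0"
    using L2_norm_eq_0_imp[OF L2(1)] by simp
  then have "u = (\<lambda>_. 0)"
    by (intro continuous_AE_eq_imp_eq indef_integral_continuous[OF u] continuous_on_const)
  then show ?thesis
    using True by simp
next
  case False
  have nn: "L2_norm u \<ge> 0" "L2_norm g \<ge> 0"
    by (simp_all add: L2_norm_def)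
  with False have pos: "L2_norm u > 0" by simp
  define B where "B = (cmod (u 0))\<^sup>2"
  \<comment> \<open>The minimiser in l of G^2 - 2 l B + l^2 U^2, where U and G are the norms of u
    and g.\<close>
  define l where "l = B / (L2_norm u)\<^sup>2"
  have "0 \<le> (L2_norm g)\<^sup>2 - 2 * l * B + l\<^sup>2 * (L2_norm u)\<^sup>2"
    unfolding B_def completed_square(2)[OF assms, symmetric] by simp
  also have "\<dots> = (L2_norm g)\<^sup>2 - B\<^sup>2 / (L2_norm u)\<^sup>2"
    using pos by (simp add: l_def power2_eq_square field_simps)
  finally have "B\<^sup>2 \<le> (L2_norm u * L2_norm g)\<^sup>2"
    using pos by (simp add: field_simps power_mult_distrib)
  then have "B \<le> L2_norm u * L2_norm g"
    by (rule power2_le_imp_le) (use nn in simp)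
  then show ?thesis
    by (simp add: B_def)
qed

lemma indef_integral_trace_eq_imp:
  assumes u: "indef_integral u g" and L2: "u \<in> L2" "g \<in> L2"
    and eq: "(cmod (u 0))\<^sup>2 = L2_norm u * L2_norm g" and nz: "u \<noteq> (\<lambda>_. 0)"
  obtains l where "l > 0" "u 0 \<noteq> 0" "\<And>x. u x = u 0 * of_real (exp (- l * \<bar>x\<bar>))"
proof -
  have "L2_norm u \<noteq> 0"
  proof
    assume "L2_norm u = 0"
    then have "AE x in lebesgue. u x = 0"
      using L2_norm_eq_0_imp[OF L2(1)] by simp
    then have "u = (\<lambda>_. 0)"
      by (intro continuous_AE_eq_imp_eq indef_integral_continuous[OF u] continuous_on_const)
    with nz show False ..
  qed
  then have pos: "L2_norm u > 0"
    by (simp add: L2_norm_def order_less_le)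
  \<comment> \<open>Under equality this ratio coincides with the minimiser |u(0)|^2 / U^2, where U
    and G are the norms of u and g, and the quadratic becomes the perfect square (G - l U)^2 =
    0.\<close>
  define l where "l = L2_norm g / L2_norm u"
  have gl: "L2_norm g = l * L2_norm u"
    using pos by (simp add: l_def)
  note cs = completed_square[OF u L2, of l]
  have "(LINT x|lebesgue. (cmod (g x + of_real (l * sgn x) * u x))\<^sup>2) = 0"
    unfolding cs(2) eq gl by (simp add: power2_eq_square algebra_simps)
  then have "AE x in lebesgue. (cmod (g x + of_real (l * sgn x) * u x))\<^sup>2 = 0"
    using integral_nonneg_eq_0_iff_AE[OF cs(1)] by simp
  then have "AE x in lebesgue. g x = - of_real (l * sgn x) * u x"
    by eventually_elim (simp add: eq_neg_iff_add_eq_0)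
  then have form: "u x = u 0 * of_real (exp (- l * \<bar>x\<bar>))" for x
    by (rule indef_integral_exp_abs[OF u])
  have u0: "u 0 \<noteq> 0"
  proof
    assume "u 0 = 0"
    then have "u x = 0" for x
      using form[of x] by simp
    with nz show False by auto
  qed
  with eq have "L2_norm g \<noteq> 0" by auto
  then have "l > 0"
    using pos by (simp add: l_def L2_norm_def order_less_le)
  with u0 form show thesis
    using that by blast
qed

text \<open>No norm of an exponential is computed. The density of u is unique almost everywhere, so
  the completed square integrates to 0 and 2 l |u(0)|^2 = G^2 + l^2 U^2 >= 2 l U G, with U and G the
  norms of u and g; this is the reverse inequality.\<close>

lemma indef_integral_exp_abs_trace_eq:
  assumes u: "indef_integral u g" and L2: "u \<in> L2" "g \<in> L2" and "l > 0"
    and form: "u = (\<lambda>x. K * of_real (exp (- l * \<bar>x\<bar>)))"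
  shows "(cmod (u 0))\<^sup>2 = L2_norm u * L2_norm g"
proof (rule antisym[OF indef_integral_trace_le[OF u L2]])
  have "indef_integral u (\<lambda>x. - of_real (l * sgn x) * u x)"
    unfolding form by (rule exp_abs_indef_integral)
  from indef_integral_AE_unique[OF u this]
  have "AE x in lebesgue. (cmod (g x + of_real (l * sgn x) * u x))\<^sup>2 = 0"
    by eventually_elim simp
  then have "(LINT x|lebesgue. (cmod (g x + of_real (l * sgn x) * u x))\<^sup>2) = 0"
    by (rule integral_eq_zero_AE)
  then have "(L2_norm g)\<^sup>2 - 2 * l * (cmod (u 0))\<^sup>2 + l\<^sup>2 * (L2_norm u)\<^sup>2 = 0"
    unfolding completed_square(2)[OF u L2] .
  moreover have "0 \<le> (L2_norm g - l * L2_norm u)\<^sup>2"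
    by simp
  ultimately have "l * (L2_norm u * L2_norm g) \<le> l * (cmod (u 0))\<^sup>2"
    by (simp add: power2_eq_square algebra_simps)
  then show "L2_norm u * L2_norm g \<le> (cmod (u 0))\<^sup>2"
    using \<open>l > 0\<close> by simp
qed

text \<open>The chosen \<open>weak_deriv\<close> is some weak derivative, not visibly the
  square-integrable one that membership in \<open>H1\<close> provides. Both have continuous
  indefinite integrals representing the same function; these coincide, so the two derivatives agree
  almost everywhere.\<close>

lemma H1_representative:
  assumes "\<psi> \<in> H1"
  obtains u where "indef_integral u (weak_deriv \<psi>)" "AE x in lebesgue. \<psi> x = u x"
    "u \<in> L2" "weak_deriv \<psi> \<in> L2"
proof -
  obtain g where \<psi>: "\<psi> \<in> L2" and g: "g \<in> L2" and wd: "has_weak_derivative \<psi> g"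
    using assms by (auto simp: H1_def)
  have "has_weak_derivative \<psi> (weak_deriv \<psi>)"
    unfolding weak_deriv_def by (rule someI[of "has_weak_derivative \<psi>", OF wd])
  then obtain u where u: "indef_integral u (weak_deriv \<psi>)" and ae: "AE x in lebesgue. \<psi> x = u x"
    by (rule weak_derivative_imp_indef_integral)
  obtain v where v: "indef_integral v g" and ae': "AE x in lebesgue. \<psi> x = v x"
    using wd by (rule weak_derivative_imp_indef_integral)
  have "AE x in lebesgue. v x = u x"
    using ae ae' by eventually_elim simp
  then have "v = u"
    by (rule continuous_AE_eq_imp_eq[OF indef_integral_continuous[OF v] indef_integral_continuous[OF u]])
  then have "AE x in lebesgue. g x = weak_deriv \<psi> x"
    using indef_integral_AE_unique[OF _ u] v by simp
  then have "weak_deriv \<psi> \<in> L2"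
    by (rule L2_AE_cong[OF g])
  moreover have "u \<in> L2"
    by (rule L2_AE_cong[OF \<psi> ae])
  ultimately show thesis
    using that u ae by blast
qed

text \<open>The characterisation of equality excludes functions vanishing almost everywhere: they
  give 0 = 0, yet are not of the stated form, since \<open>\<alpha> > 0\<close> and the ground state
  is positive.\<close>

theorem proposition1p3:
  fixes p :: real and \<psi> :: "real \<Rightarrow> complex"
  assumes "p > 1" and "\<psi> \<in> H1"
  shows "(cmod (cont_rep \<psi> 0))\<^sup>2 \<le> L2_norm \<psi> * L2_norm (weak_deriv \<psi>) \<and>
         (\<not> (AE x in lebesgue. \<psi> x = 0) \<longrightarrow>
           ((cmod (cont_rep \<psi> 0))\<^sup>2 = L2_norm \<psi> * L2_norm (weak_deriv \<psi>) \<longleftrightarrow>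
            (\<exists>\<theta> \<alpha> \<beta> :: real. \<alpha> > 0 \<and> \<beta> > 0 \<and>
               (AE x in lebesgue.
                  \<psi> x = exp (\<i> * of_real \<theta>) * of_real (\<alpha> * ground_state p (\<beta> * x))))))"
proof -
  obtain u where u: "indef_integral u (weak_deriv \<psi>)" and ae: "AE x in lebesgue. \<psi> x = u x"
    and L2: "u \<in> L2" "weak_deriv \<psi> \<in> L2"
    using H1_representative[OF assms(2)] .
  have rep: "cont_rep \<psi> = u"
    by (rule cont_rep_eq[OF indef_integral_continuous[OF u] ae])
  have norm: "L2_norm \<psi> = L2_norm u"
    by (rule L2_norm_AE_cong[OF _ ae]) (use assms(2) in \<open>simp add: H1_def\<close>)
  define c where "c = (2 :: real) powr (1 / (p - 1))"
  have c: "c > 0"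
    by (simp add: c_def)
  have gs: "\<alpha> * ground_state p (\<beta> * x) = \<alpha> * c * exp (- \<beta> * \<bar>x\<bar>)" if "\<beta> > 0" for \<alpha> \<beta> x
    using that by (simp add: ground_state_def c_def abs_mult)
  show ?thesis
    unfolding rep norm
  proof (intro conjI impI iffI)
    show "(cmod (u 0))\<^sup>2 \<le> L2_norm u * L2_norm (weak_deriv \<psi>)"
      by (rule indef_integral_trace_le[OF u L2])
  next
    assume nz: "\<not> (AE x in lebesgue. \<psi> x = 0)"
      and eq: "(cmod (u 0))\<^sup>2 = L2_norm u * L2_norm (weak_deriv \<psi>)"
    have "u \<noteq> (\<lambda>_. 0)"
      using nz ae by auto
    then obtain l where l: "l > 0" "u 0 \<noteq> 0" and form: "\<And>x. u x = u 0 * of_real (exp (- l * \<bar>x\<bar>))"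
      using indef_integral_trace_eq_imp[OF u L2 eq] by blast
    \<comment> \<open>The ground state has the value \<open>c\<close> at 0, so this amplitude
      matches the modulus of \<open>u 0\<close>; the phase is its argument and the scale is the
      decay rate \<open>l\<close>.\<close>
    define \<alpha> where "\<alpha> = cmod (u 0) / c"
    have "AE x in lebesgue. \<psi> x = exp (\<i> * of_real (Arg (u 0))) * of_real (\<alpha> * ground_state p (l * x))"
      using ae
    proof eventually_elim
      case (elim x)
      have "u 0 = of_real (cmod (u 0)) * exp (\<i> * of_real (Arg (u 0)))"
        using l(2) by (rule Arg_eq)
      moreover have "\<alpha> * c = cmod (u 0)"
        using c by (simp add: \<alpha>_def)
      ultimately show ?case
        unfolding elim gs[OF l(1)] by (subst form) (simp add: mult.commute)
    qed
    moreover have "\<alpha> > 0"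
      using l c by (simp add: \<alpha>_def)
    ultimately show "\<exists>\<theta> \<alpha> \<beta> :: real. \<alpha> > 0 \<and> \<beta> > 0 \<and>
        (AE x in lebesgue. \<psi> x = exp (\<i> * of_real \<theta>) * of_real (\<alpha> * ground_state p (\<beta> * x)))"
      using l(1) by blast
  next
    assume "\<exists>\<theta> \<alpha> \<beta> :: real. \<alpha> > 0 \<and> \<beta> > 0 \<and>
        (AE x in lebesgue. \<psi> x = exp (\<i> * of_real \<theta>) * of_real (\<alpha> * ground_state p (\<beta> * x)))"
    then obtain \<theta> \<alpha> \<beta> :: real where \<beta>: "\<beta> > 0"
      and ae': "AE x in lebesgue. \<psi> x = exp (\<i> * of_real \<theta>) * of_real (\<alpha> * ground_state p (\<beta> * x))"
      by blast
    define K where "K = exp (\<i> * of_real \<theta>) * of_real (\<alpha> * c)"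
    have "AE x in lebesgue. u x = K * of_real (exp (- \<beta> * \<bar>x\<bar>))"
      using ae ae' by eventually_elim (simp add: K_def gs[OF \<beta>] mult.assoc)
    \<comment> \<open>Both sides are continuous, so equality almost everywhere becomes equality at
      every point, including the origin where the trace is taken.\<close>
    then have "u = (\<lambda>x. K * of_real (exp (- \<beta> * \<bar>x\<bar>)))"
      by (intro continuous_AE_eq_imp_eq indef_integral_continuous[OF u] continuous_intros)
    then show "(cmod (u 0))\<^sup>2 = L2_norm u * L2_norm (weak_deriv \<psi>)"
      by (rule indef_integral_exp_abs_trace_eq[OF u L2 \<beta>])
  qed
qed

end
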